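(* Let $X_1,X_2,\dots$ be i.i.d. real random variables with $\mathbb{E}(X_1)=0$ and $0<\operatorname{Var}(X_1)<\infty$, and let $S(n)=\sum_{i=1}^{n}X_i$ for $n\ge 0$. Then for every $\varepsilon>0$ and all $n$ large enough, $$\mathbb{E}\operatorname{LIS}(S|_{[0,n)})\leq n^{1/2+\varepsilon}.$$
   Context: $\mathbb{N}=\{0,1,2,\dots\}$, and $[0,n)$ denotes $\{0,1,\dots,n-1\}$. For $S\colon\mathbb{N}\to\mathbb{R}$ and $A\subset\mathbb{N}$, $S|_A$ is called increasing if $S(a)\le S(b)$ for all $a,b\in A$ with $a\le b$ (weakly increasing). Define $\operatorname{LIS}(S|_{[0,n)})=\max\{|A|: A\subset[0,n),\ S|_A \text{ is increasing}\}$. *)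

theory Defs
  imports "HOL-Probability.Probability"
begin

(* Meaningful for finite I only; the empty set always qualifies, so Max then ranges over a
   finite nonempty set.  mono_on A S is weak monotonicity, as intended here. *)
definition LIS :: "(nat \<Rightarrow> real) \<Rightarrow> nat set \<Rightarrow> nat" where
  "LIS S I = Max {card A | A. A \<subseteq> I \<and> mono_on A S}"

definition partial_sum :: "(nat \<Rightarrow> 'a \<Rightarrow> real) \<Rightarrow> 'a \<Rightarrow> nat \<Rightarrow> real" where
  "partial_sum X \<omega> n = (\<Sum>i=1..n. X i \<omega>)"

end

theory Submission
  imports Defs "HOL-Real_Asymp.Real_Asymp"
begin

text \<open>
  The exponent \<open>1/2\<close> comes from local times.  In \<open>T\<close> steps a centred walk of finite variance spends
  about \<open>sqrt T\<close> steps within bounded distance of its present position, and an increasing subset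
  can collect many indices only by returning to the same heights or by climbing; the walk climbs only
  \<open>sqrt n\<close> in total.

  To exploit this one compares consecutive time scales \<open>m = r ^ i\<close> with \<open>r\<close> about \<open>n powr (1 / J)\<close>.
  Let \<open>U m\<close> be the number of time blocks of length \<open>m\<close> that an increasing set \<open>A\<close> meets.  Along \<open>A\<close>,
  both the index of the block of length \<open>r * m\<close> and the index of the horizontal strip of height
  \<open>sqrt m\<close> are monotone, so the cells (block, strip) that \<open>A\<close> meets form a staircase, and there are at
  most \<open>U (r * m) + 2 * H / sqrt m + 2\<close> of them when the walk stays in \<open>{-H..H}\<close>
  (\<open>card_staircase_le\<close>).  Inside one cell the blocks of length \<open>m\<close> are visits of the walk to a strip
  of height \<open>sqrt m\<close> during \<open>r * m\<close> steps; their number is at most \<open>Q\<close>, of order \<open>sqrt r * log n\<close>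
  (\<open>card_blocks_coarsen\<close>).  Iterating \<open>U m \<le> Q * (U (r * m) + 2 * H / sqrt m + 2)\<close> through the \<open>J\<close>
  scales gives \<open>card A\<close> at most \<open>(log n) ^ J * (sqrt n + sqrt r * H)\<close> up to constants
  (\<open>card_increasing_le\<close>): the factors \<open>sqrt r\<close> and \<open>1 / sqrt m\<close> cancel at every scale, and only one
  factor \<open>sqrt r = n powr (1 / (2 * J))\<close> is lost.  As \<open>H\<close> has expectation of order \<open>sqrt n\<close>, a large
  \<open>J\<close> makes the total exponent smaller than \<open>1/2 + \<epsilon>\<close>.

  The probabilistic input is the bound \<open>Q\<close>, uniformly over all starting indices and scales, with only
  two moments available.  A Huber function (quadratic near the origin, linear far away) of the walk is a
  submartingale whose drift is bounded below on a strip and whose growth is at most linear, which bounds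
  the expected occupation time of the strip (\<open>occupation_bound\<close>).  At each of the \<open>m\<close> times after
  hitting the strip the walk is, by Chebyshev, still close to it with probability at least \<open>1/2\<close>, so
  the expected number of visited blocks is \<open>O(sqrt r)\<close> from every starting point (\<open>expected_visits_bound\<close>).  By the
  Markov property this expectation bound upgrades itself to a geometric tail (\<open>visits_tail\<close>), which
  survives the union over starting indices and scales.  Everything is computed on the space of step
  sequences, and the expectation of \<open>LIS\<close> is compared with that of a dominating function there.
\<close>

section \<open>Increasing sets at consecutive time scales\<close>

text \<open>
  The pairs form a chain in a product order; each new pair along the chain increases at least one
  coordinate.
\<close>
lemma card_staircase_le:
  fixes g :: "'a::linorder \<Rightarrow> 'b::order" and h :: "'a \<Rightarrow> 'c::order"
  assumes "finite A" "mono_on A g" "mono_on A h"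
  shows "card ((\<lambda>t. (g t, h t)) ` A) \<le> card (g ` A) + card (h ` A)"
  using assms
proof (induction A rule: finite_linorder_max_induct)
  case empty
  then show ?case by simp
next
  case (insert b A)
  have mono: "mono_on A g" "mono_on A h"
    using insert.prems by (auto intro: mono_on_subset)
  have IH: "card ((\<lambda>t. (g t, h t)) ` A) \<le> card (g ` A) + card (h ` A)"
    using insert.IH mono by blast
  show ?case
  proof (cases "(g b, h b) \<in> (\<lambda>t. (g t, h t)) ` A")
    case True
    have "card (g ` A) \<le> card (g ` insert b A)" "card (h ` A) \<le> card (h ` insert b A)"
      using insert.hyps by (auto intro!: card_mono)
    with True IH show ?thesis by (simp add: insert_absorb)
  next
    case False
    have "g b \<notin> g ` A \<or> h b \<notin> h ` A"
    proof (rule ccontr)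
      assume "\<not> ?thesis"
      then obtain s s' where s: "s \<in> A" "g s = g b" "s' \<in> A" "h s' = h b" by force
      define u where "u = max s s'"
      have u: "u \<in> A" "s \<le> u" "s' \<le> u" "u \<le> b"
        using s insert.hyps by (auto simp: u_def max_def intro: less_imp_le)
      have "g b \<le> g u" "h b \<le> h u"
        using mono_onD[OF mono(1) s(1) u(1,2)] mono_onD[OF mono(2) s(3) u(1,3)] s by simp_all
      moreover have "g u \<le> g b" "h u \<le> h b"
        using mono_onD[OF insert.prems(1), of u b] mono_onD[OF insert.prems(2), of u b] u by simp_all
      ultimately have "g u = g b" "h u = h b" by simp_all
      hence "(g b, h b) \<in> (\<lambda>t. (g t, h t)) ` A" using u(1) by (intro image_eqI[of _ _ u]) simp_all
      with False show False by contradiction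
    qed
    moreover have "card (g ` insert b A) = card (g ` A) + (if g b \<in> g ` A then 0 else 1)"
      "card (h ` insert b A) = card (h ` A) + (if h b \<in> h ` A then 0 else 1)"
      using insert.hyps by (auto simp: card_insert_if)
    ultimately show ?thesis using False IH insert.hyps by (auto simp: card_insert_if split: if_splits)
  qed
qed

text \<open>
  The block that contains \<open>a\<close> itself is excluded and only later blocks are counted, so that for a
  random walk this number depends only on the position at time \<open>a\<close> and on what happens after the end of
  that block.
\<close>
definition returns :: "(nat \<Rightarrow> real) \<Rightarrow> nat \<Rightarrow> nat \<Rightarrow> nat \<Rightarrow> nat" where
  "returns f r m a = card {j. a div m < j \<and> j \<le> a div m + r \<and>
     (\<exists>t. t div m = j \<and> \<bar>f t - f a\<bar> \<le> sqrt m)}"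

text \<open>
  The renormalisation step.  Points of \<open>A\<close> in a common cell (coarse block, strip) all lie within
  \<open>sqrt m\<close> of the earliest of them and at most \<open>r\<close> fine blocks later, so the fine blocks of a cell are
  counted by \<open>returns\<close>, except for the first one, for which the strict inequality leaves room.
\<close>
lemma card_blocks_coarsen:
  fixes f :: "nat \<Rightarrow> real"
  assumes "finite A" "mono_on A f" "0 < m" "0 < r"
    and returns: "\<And>a. a \<in> A \<Longrightarrow> returns f r m a < Q"
  shows "card ((\<lambda>t. t div m) ` A)
    \<le> Q * (card ((\<lambda>t. t div (m * r)) ` A) + card ((\<lambda>t. \<lfloor>f t / sqrt m\<rfloor>) ` A))"
proof -
  define cell where "cell t = (t div (m * r), \<lfloor>f t / sqrt m\<rfloor>)" for t
  define fibre where "fibre p = {t \<in> A. cell t = p}" for p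
  have fibre_card: "card ((\<lambda>t. t div m) ` fibre p) \<le> Q" if p: "p \<in> cell ` A" for p
  proof -
    have fin: "finite (fibre p)" and ne: "fibre p \<noteq> {}"
      using p assms by (auto simp: fibre_def)
    define a where "a = Min (fibre p)"
    define R where "R = {j. a div m < j \<and> j \<le> a div m + r \<and>
      (\<exists>t. t div m = j \<and> \<bar>f t - f a\<bar> \<le> sqrt m)}"
    have a: "a \<in> fibre p" using fin ne by (simp add: a_def)
    have "(\<lambda>t. t div m) ` fibre p \<subseteq> insert (a div m) R"
    proof safe
      fix t assume t: "t \<in> fibre p" and neq: "t div m \<notin> R"
      have le: "a \<le> t" using t fin by (simp add: a_def)
      have "cell t = cell a" using a t by (simp add: fibre_def)
      hence big: "t div m div r = a div m div r" and fl: "\<lfloor>f t / sqrt m\<rfloor> = \<lfloor>f a / sqrt m\<rfloor>"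
        by (auto simp: cell_def div_mult2_eq)
      have "\<bar>f t / sqrt m - f a / sqrt m\<bar> \<le> 1" using fl by linarith
      hence "\<bar>f t - f a\<bar> / sqrt m \<le> 1"
        using assms(3) by (simp flip: diff_divide_distrib)
      hence 1: "\<bar>f t - f a\<bar> \<le> sqrt m" using assms(3) by (simp add: divide_simps split: if_splits)
      have "t div m < r + t div m div r * r"
        using assms(4) by (rule dividend_less_div_times)
      also have "\<dots> \<le> r + a div m" unfolding big by simp
      finally have "t div m \<le> a div m + r" by simp
      with 1 neq have "\<not> a div m < t div m" unfolding R_def by blast
      moreover have "a div m \<le> t div m" using le by (rule div_le_mono)
      ultimately show "t div m = a div m" by simp
    qed
    moreover have "finite R" by (rule finite_subset[of _ "{..a div m + r}"]) (auto simp: R_def)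
    ultimately have "card ((\<lambda>t. t div m) ` fibre p) \<le> card (insert (a div m) R)"
      by (intro card_mono) simp_all
    also have "\<dots> \<le> Suc (card R)" by (metis card.infinite card_insert_if finite_insert le_SucI order_refl)
    also have "card R = returns f r m a" by (simp add: R_def returns_def)
    finally show ?thesis using returns[of a] a by (simp add: fibre_def)
  qed
  have "(\<lambda>t. t div m) ` A = (\<Union>p\<in>cell ` A. (\<lambda>t. t div m) ` fibre p)"
    by (auto simp: fibre_def)
  also have "card \<dots> \<le> (\<Sum>p\<in>cell ` A. card ((\<lambda>t. t div m) ` fibre p))"
    using assms by (intro card_UN_le) auto
  also have "\<dots> \<le> card (cell ` A) * Q"
    using sum_bounded_above[of "cell ` A" "\<lambda>p. card ((\<lambda>t. t div m) ` fibre p)" Q] fibre_card by simp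
  also have "card (cell ` A) \<le> card ((\<lambda>t. t div (m * r)) ` A) + card ((\<lambda>t. \<lfloor>f t / sqrt m\<rfloor>) ` A)"
    unfolding cell_def
  proof (intro card_staircase_le)
    show "mono_on A (\<lambda>t. t div (m * r))" by (auto simp: mono_on_def intro: div_le_mono)
    show "mono_on A (\<lambda>t. \<lfloor>f t / sqrt m\<rfloor>)"
      using assms(2,3) by (auto simp: mono_on_def intro!: floor_mono divide_right_mono)
  qed fact
  finally show ?thesis by (simp add: mult.commute)
qed

lemma card_levels_le:
  fixes f :: "nat \<Rightarrow> real"
  assumes f: "\<And>t. t \<in> A \<Longrightarrow> \<bar>f t\<bar> \<le> H" and "0 \<le> H" "0 < d"
  shows "real (card ((\<lambda>t. \<lfloor>f t / d\<rfloor>) ` A)) \<le> 2 * H / d + 2"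
proof -
  define z where "z = H / d"
  have z: "0 \<le> z" using assms by (simp add: z_def)
  have "\<lfloor>f t / d\<rfloor> \<in> {\<lfloor>- z\<rfloor>..\<lfloor>z\<rfloor>}" if "t \<in> A" for t
  proof -
    have "\<bar>f t / d\<bar> \<le> z"
      using f[OF that] \<open>0 < d\<close> by (simp add: z_def divide_right_mono)
    hence "f t / d \<le> z" "- z \<le> f t / d" by linarith+
    thus ?thesis by (simp add: floor_mono)
  qed
  hence "(\<lambda>t. \<lfloor>f t / d\<rfloor>) ` A \<subseteq> {\<lfloor>- z\<rfloor>..\<lfloor>z\<rfloor>}" by blast
  hence "card ((\<lambda>t. \<lfloor>f t / d\<rfloor>) ` A) \<le> card {\<lfloor>- z\<rfloor>..\<lfloor>z\<rfloor>}" by (intro card_mono) simp_all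
  hence "card ((\<lambda>t. \<lfloor>f t / d\<rfloor>) ` A) \<le> nat (\<lfloor>z\<rfloor> + 1 - \<lfloor>- z\<rfloor>)" by (simp only: card_atLeastAtMost_int)
  moreover have "real_of_int \<lfloor>z\<rfloor> \<le> z" "- z < real_of_int \<lfloor>- z\<rfloor> + 1" by linarith+
  moreover have "\<lfloor>- z\<rfloor> \<le> \<lfloor>z\<rfloor>" using z by (intro floor_mono) simp
  ultimately have "real (card ((\<lambda>t. \<lfloor>f t / d\<rfloor>) ` A)) \<le> 2 * z + 2" by linarith
  thus ?thesis by (simp add: z_def)
qed

text \<open>
  At the coarsest scale \<open>r ^ J\<close> a single block covers all of \<open>{0..<n}\<close>, and at the finest scale the
  blocks are the indices themselves, so iterating the renormalisation step counts \<open>A\<close>.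
\<close>
theorem card_increasing_le:
  fixes f :: "nat \<Rightarrow> real"
  assumes A: "A \<subseteq> {0..<n}" "mono_on A f" and r: "0 < r" "n \<le> r ^ J"
    and H: "\<And>t. t < n \<Longrightarrow> \<bar>f t\<bar> \<le> H" "0 \<le> H"
    and returns: "\<And>a i. a < n \<Longrightarrow> i < J \<Longrightarrow> returns f r (r ^ i) a < Q"
  shows "real (card A) \<le> real Q ^ J + (\<Sum>i<J. real Q ^ Suc i * (2 * H / sqrt (r ^ i) + 2))"
proof -
  define U where "U i = real (card ((\<lambda>t. t div r ^ i) ` A))" for i
  have fin: "finite A" using A(1) finite_subset by blast
  have step: "U i \<le> Q * (U (Suc i) + (2 * H / sqrt (r ^ i) + 2))" if "i < J" for i
  proof -
    have "card ((\<lambda>t. t div r ^ i) ` A) \<le> Q * (card ((\<lambda>t. t div (r ^ i * r)) ` A)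
            + card ((\<lambda>t. \<lfloor>f t / sqrt (real (r ^ i))\<rfloor>) ` A))"
      using A r returns[OF _ that] by (intro card_blocks_coarsen fin) auto
    hence "U i \<le> Q * (U (Suc i) + card ((\<lambda>t. \<lfloor>f t / sqrt (real (r ^ i))\<rfloor>) ` A))"
      unfolding U_def power_Suc2 by (simp flip: of_nat_add of_nat_mult of_nat_power)
    also have "\<dots> \<le> Q * (U (Suc i) + (2 * H / sqrt (r ^ i) + 2))"
      using A H r by (intro mult_left_mono add_left_mono card_levels_le) auto
    finally show ?thesis .
  qed
  have "U 0 \<le> real Q ^ k * U k + (\<Sum>i<k. real Q ^ Suc i * (2 * H / sqrt (r ^ i) + 2))"
    if "k \<le> J" for k
    using that
  proof (induction k)
    case (Suc k)
    have "real Q ^ k * U k \<le> real Q ^ k * (Q * (U (Suc k) + (2 * H / sqrt (r ^ k) + 2)))"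
      using step[of k] Suc.prems by (intro mult_left_mono) auto
    also have "\<dots> = real Q ^ Suc k * U (Suc k) + real Q ^ Suc k * (2 * H / sqrt (r ^ k) + 2)"
      by (simp add: algebra_simps)
    finally show ?case using Suc by simp
  qed simp
  from this[of J] have "U 0 \<le> real Q ^ J * U J + (\<Sum>i<J. real Q ^ Suc i * (2 * H / sqrt (r ^ i) + 2))"
    by simp
  moreover have "(\<lambda>t. t div r ^ J) ` A \<subseteq> {0}" using A(1) r by force
  hence "card ((\<lambda>t. t div r ^ J) ` A) \<le> 1" using card_mono[of "{0::nat}"] by (metis card.empty card_insert_if finite.intros empty_iff One_nat_def)
  hence "U J \<le> 1" unfolding U_def by simp
  hence "real Q ^ J * U J \<le> real Q ^ J" by (simp add: mult_left_le)
  moreover have "U 0 = card A" by (simp add: U_def)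
  ultimately show ?thesis by linarith
qed

section \<open>Random walk on the space of step sequences\<close>
definition walk :: "(nat \<Rightarrow> real) \<Rightarrow> nat \<Rightarrow> real" where
  "walk \<omega> t = (\<Sum>i<t. \<omega> i)"

lemma walk_0 [simp]: "walk \<omega> 0 = 0"
  and walk_Suc: "walk \<omega> (Suc t) = walk \<omega> t + \<omega> t"
  by (simp_all add: walk_def)

lemma walk_comb_seq_le: "s \<le> t \<Longrightarrow> walk (comb_seq t \<omega> \<omega>') s = walk \<omega> s"
  unfolding walk_def by (intro sum.cong) (auto simp: comb_seq_def)

lemma walk_comb_seq_add: "walk (comb_seq t \<omega> \<omega>') (t + s) = walk \<omega> t + walk \<omega>' s"
proof (induction s)
  case 0
  show ?case by (simp add: walk_comb_seq_le)
next
  case (Suc s)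
  thus ?case by (simp add: walk_Suc comb_seq_def)
qed

locale random_walk = step: prob_space \<mu> for \<mu> :: "real measure" +
  assumes sets_step [measurable_cong]: "sets \<mu> = sets borel"
    and square_integrable: "integrable \<mu> (\<lambda>x. x\<^sup>2)"
    and mean_zero: "(\<integral>x. x \<partial>\<mu>) = 0"
    and nondegenerate: "0 < (\<integral>x. x\<^sup>2 \<partial>\<mu>)"

sublocale random_walk \<subseteq> sequence_space \<mu>
  by unfold_locales

context random_walk
begin

lemma space_paths [simp]: "space S = UNIV"
  using sets_eq_imp_space_eq[OF sets_step] by (simp add: space_PiM PiE_def extensional_def)

lemma prob_UNIV [simp]: "measure S UNIV = 1"
  using P.prob_space by simp

lemma coordinate_measurable [measurable]: "(\<lambda>\<omega>. \<omega> i) \<in> borel_measurable S"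
proof -
  have "(\<lambda>\<omega>. \<omega> i) \<in> measurable S \<mu>" by (rule measurable_component_singleton) simp
  thus ?thesis by (simp add: measurable_cong_sets[OF refl sets_step])
qed

lemma walk_measurable [measurable]: "(\<lambda>\<omega>. walk \<omega> t) \<in> borel_measurable S"
  unfolding walk_def by measurable

lemma step_integrable: "integrable \<mu> (\<lambda>x. x)"
  by (rule step.square_integrable_imp_integrable[OF _ square_integrable])
    (simp add: measurable_cong_sets[OF sets_step refl])

lemma
  fixes f :: "real \<Rightarrow> real"
  assumes [measurable]: "f \<in> borel_measurable borel"
  shows integrable_coordinate: "integrable S (\<lambda>\<omega>. f (\<omega> i)) \<longleftrightarrow> integrable \<mu> f"
    and integral_coordinate: "(\<integral>\<omega>. f (\<omega> i) \<partial>S) = (\<integral>x. f x \<partial>\<mu>)"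
proof -
  have [measurable]: "(\<lambda>\<omega>. \<omega> i) \<in> measurable S \<mu>" by (rule measurable_component_singleton) simp
  have D: "distr S \<mu> (\<lambda>\<omega>. \<omega> i) = \<mu>" by (rule PiM_component) simp
  have f: "f \<in> borel_measurable \<mu>" using assms by (simp add: measurable_cong_sets[OF sets_step refl])
  show "integrable S (\<lambda>\<omega>. f (\<omega> i)) \<longleftrightarrow> integrable \<mu> f"
    using integrable_distr_eq[of "\<lambda>\<omega>. \<omega> i" S \<mu> f] f by (simp add: D)
  show "(\<integral>\<omega>. f (\<omega> i) \<partial>S) = (\<integral>x. f x \<partial>\<mu>)"
    using integral_distr[of "\<lambda>\<omega>. \<omega> i" S \<mu> f] f by (simp add: D)
qed

text \<open>
  Resampling all steps from time \<open>t\<close> on preserves the law of the walk; Fubini then expresses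
  conditioning on the first \<open>t\<close> steps as an inner integral.
\<close>
lemma integral_split:
  fixes F :: "(nat \<Rightarrow> real) \<Rightarrow> real"
  assumes F: "integrable S F"
  shows "AE \<omega> in S. integrable S (\<lambda>\<omega>'. F (comb_seq t \<omega> \<omega>'))"
    and "integrable S (\<lambda>\<omega>. \<integral>\<omega>'. F (comb_seq t \<omega> \<omega>') \<partial>S)"
    and "(\<integral>\<omega>. (\<integral>\<omega>'. F (comb_seq t \<omega> \<omega>') \<partial>S) \<partial>S) = (\<integral>\<omega>. F \<omega> \<partial>S)"
proof -
  interpret PS: pair_sigma_finite S S ..
  have [measurable]: "F \<in> borel_measurable S" using F by simp
  have m: "(\<lambda>(\<omega>, \<omega>'). comb_seq t \<omega> \<omega>') \<in> measurable (S \<Otimes>\<^sub>M S) S" by (rule measurable_comb_seq)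
  have "integrable (distr (S \<Otimes>\<^sub>M S) S (\<lambda>(\<omega>, \<omega>'). comb_seq t \<omega> \<omega>')) F" using F by (simp add: PiM_comb_seq)
  hence i: "integrable (S \<Otimes>\<^sub>M S) (\<lambda>(\<omega>, \<omega>'). F (comb_seq t \<omega> \<omega>'))"
    using integrable_distr[OF m] by (simp add: split_beta')
  show "AE \<omega> in S. integrable S (\<lambda>\<omega>'. F (comb_seq t \<omega> \<omega>'))" by (rule PS.AE_integrable_fst[OF i])
  show "integrable S (\<lambda>\<omega>. \<integral>\<omega>'. F (comb_seq t \<omega> \<omega>') \<partial>S)" by (rule PS.integrable_fst[OF i])
  have "(\<integral>\<omega>. (\<integral>\<omega>'. F (comb_seq t \<omega> \<omega>') \<partial>S) \<partial>S) = (\<integral>p. (case p of (\<omega>, \<omega>') \<Rightarrow> F (comb_seq t \<omega> \<omega>')) \<partial>(S \<Otimes>\<^sub>M S))"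
    by (rule PS.integral_fst[OF i])
  also have "\<dots> = (\<integral>\<omega>. F \<omega> \<partial>distr (S \<Otimes>\<^sub>M S) S (\<lambda>(\<omega>, \<omega>'). comb_seq t \<omega> \<omega>'))"
    using integral_distr[OF m, of F] by (simp add: split_beta')
  finally show "(\<integral>\<omega>. (\<integral>\<omega>'. F (comb_seq t \<omega> \<omega>') \<partial>S) \<partial>S) = (\<integral>\<omega>. F \<omega> \<partial>S)"
    by (simp add: PiM_comb_seq)
qed

text \<open>
  One-step drift estimate, where \<open>\<omega>\<close> supplies the first \<open>t\<close> steps and \<open>\<omega>' 0\<close> is the next one.  The
  term that is linear in the next step leaves no trace in the conclusion because the steps are centred.
\<close>
lemma expectation_step_ge:
  fixes F G b d :: "(nat \<Rightarrow> real) \<Rightarrow> real" and q :: "real \<Rightarrow> real"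
  assumes F: "integrable S F" and G: "integrable S G" and d: "integrable S d" and q: "integrable \<mu> q"
    and le: "\<And>\<omega> \<omega>'. G \<omega> + b \<omega> * \<omega>' 0 + d \<omega> * q (\<omega>' 0) \<le> F (comb_seq t \<omega> \<omega>')"
  shows "(\<integral>\<omega>. G \<omega> \<partial>S) + (\<integral>\<omega>. d \<omega> \<partial>S) * (\<integral>x. q x \<partial>\<mu>) \<le> (\<integral>\<omega>. F \<omega> \<partial>S)"
proof -
  have q': "q \<in> borel_measurable borel"
    using borel_measurable_integrable[OF q] by (simp add: measurable_cong_sets[OF sets_step refl])
  have "(\<integral>\<omega>. G \<omega> \<partial>S) + (\<integral>\<omega>. d \<omega> \<partial>S) * (\<integral>x. q x \<partial>\<mu>) = (\<integral>\<omega>. G \<omega> + d \<omega> * (\<integral>x. q x \<partial>\<mu>) \<partial>S)"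
    using G d by simp
  also have "\<dots> \<le> (\<integral>\<omega>. (\<integral>\<omega>'. F (comb_seq t \<omega> \<omega>') \<partial>S) \<partial>S)"
  proof (rule integral_mono_AE)
    show "integrable S (\<lambda>\<omega>. G \<omega> + d \<omega> * (\<integral>x. q x \<partial>\<mu>))" using G d by simp
    show "integrable S (\<lambda>\<omega>. \<integral>\<omega>'. F (comb_seq t \<omega> \<omega>') \<partial>S)" by (rule integral_split[OF F])
    show "AE \<omega> in S. G \<omega> + d \<omega> * (\<integral>x. q x \<partial>\<mu>) \<le> (\<integral>\<omega>'. F (comb_seq t \<omega> \<omega>') \<partial>S)"
      using integral_split(1)[OF F, of t]
    proof eventually_elim
      case (elim \<omega>)
      have i: "integrable S (\<lambda>\<omega>'. \<omega>' 0)" "integrable S (\<lambda>\<omega>'. q (\<omega>' 0))"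
        by (rule integrable_coordinate[THEN iffD2], simp, rule step_integrable,
            rule integrable_coordinate[THEN iffD2, OF q' q])
      have "(\<integral>\<omega>'. G \<omega> + b \<omega> * \<omega>' 0 + d \<omega> * q (\<omega>' 0) \<partial>S) \<le> (\<integral>\<omega>'. F (comb_seq t \<omega> \<omega>') \<partial>S)"
        using i by (intro integral_mono elim le) simp
      thus ?case
        using i integral_coordinate[of "\<lambda>x. x" 0] integral_coordinate[OF q', of 0]
        by (simp add: mean_zero P.prob_space)
    qed
  qed
  also have "\<dots> = (\<integral>\<omega>. F \<omega> \<partial>S)" by (rule integral_split[OF F])
  finally show ?thesis .
qed

lemma event_sets: "Measurable.pred S B \<Longrightarrow> {\<omega>. B \<omega>} \<in> sets S"
  by (drule predE) simp

lemma integrable_event: "Measurable.pred S B \<Longrightarrow> integrable S (indicator {\<omega>. B \<omega>} :: _ \<Rightarrow> real)"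
  by (intro integrable_real_indicator event_sets) (simp_all add: P.emeasure_eq_measure)

text \<open>
  The Markov property at a fixed time, for events \<open>B\<close> that are decided by the first \<open>t\<close> steps, followed
  by the two one-sided estimates that are used later.
\<close>
lemma prob_split:
  assumes [measurable]: "Measurable.pred S B" "Measurable.pred S E"
    and past: "\<And>\<omega> \<omega>'. B (comb_seq t \<omega> \<omega>') \<longleftrightarrow> B \<omega>"
  shows "integrable S (\<lambda>\<omega>. indicator {\<omega>. B \<omega>} \<omega> * \<P>(\<omega>' in S. E (comb_seq t \<omega> \<omega>')))" (is ?int)
    and "\<P>(\<omega> in S. B \<omega> \<and> E \<omega>) = (\<integral>\<omega>. indicator {\<omega>. B \<omega>} \<omega> * \<P>(\<omega>' in S. E (comb_seq t \<omega> \<omega>')) \<partial>S)" (is ?eq)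
proof -
  define F :: "(nat \<Rightarrow> real) \<Rightarrow> real" where "F = indicator {\<omega>. B \<omega> \<and> E \<omega>}"
  have F: "integrable S F" unfolding F_def by (rule integrable_event) measurable
  have *: "(\<integral>\<omega>'. F (comb_seq t \<omega> \<omega>') \<partial>S) = indicator {\<omega>. B \<omega>} \<omega> * \<P>(\<omega>' in S. E (comb_seq t \<omega> \<omega>'))" for \<omega>
  proof -
    have "Measurable.pred S (\<lambda>\<omega>'. E (comb_seq t \<omega> \<omega>'))"
      by (rule measurable_compose[OF measurable_comb_seq' assms(2)]) simp_all
    hence sets: "{\<omega>' \<in> space S. E (comb_seq t \<omega> \<omega>')} \<in> sets S" by (rule predE)
    have "F (comb_seq t \<omega> \<omega>') = indicator {\<omega>. B \<omega>} \<omega> * indicator {\<omega>' \<in> space S. E (comb_seq t \<omega> \<omega>')} \<omega>'" for \<omega>'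
      by (simp add: F_def past indicator_def)
    thus ?thesis using sets by simp
  qed
  show ?int using integral_split(2)[OF F, of t] by (simp only: *)
  have "\<P>(\<omega> in S. B \<omega> \<and> E \<omega>) = (\<integral>\<omega>. F \<omega> \<partial>S)" by (simp add: F_def)
  thus ?eq using integral_split(3)[OF F, of t] by (simp only: *)
qed

lemma markov_le:
  assumes [measurable]: "Measurable.pred S B" "Measurable.pred S E"
    and past: "\<And>\<omega> \<omega>'. B (comb_seq t \<omega> \<omega>') \<longleftrightarrow> B \<omega>"
    and le: "\<And>\<omega>. B \<omega> \<Longrightarrow> \<P>(\<omega>' in S. E (comb_seq t \<omega> \<omega>')) \<le> q"
  shows "\<P>(\<omega> in S. B \<omega> \<and> E \<omega>) \<le> q * \<P>(\<omega> in S. B \<omega>)"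
proof -
  have int: "integrable S (indicator {\<omega>. B \<omega>} :: _ \<Rightarrow> real)" by (rule integrable_event) measurable
  have "\<P>(\<omega> in S. B \<omega> \<and> E \<omega>) \<le> (\<integral>\<omega>. q * indicator {\<omega>. B \<omega>} \<omega> \<partial>S)"
    unfolding prob_split(2)[OF assms(1-3)]
    using int le by (intro integral_mono prob_split(1) assms(1-3) integrable_mult_right int) (auto simp: indicator_def)
  thus ?thesis by simp
qed

lemma markov_ge:
  assumes [measurable]: "Measurable.pred S B" "Measurable.pred S E"
    and past: "\<And>\<omega> \<omega>'. B (comb_seq t \<omega> \<omega>') \<longleftrightarrow> B \<omega>"
    and le: "\<And>\<omega>. B \<omega> \<Longrightarrow> q \<le> \<P>(\<omega>' in S. E (comb_seq t \<omega> \<omega>'))"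
  shows "q * \<P>(\<omega> in S. B \<omega>) \<le> \<P>(\<omega> in S. B \<omega> \<and> E \<omega>)"
proof -
  have int: "integrable S (indicator {\<omega>. B \<omega>} :: _ \<Rightarrow> real)" by (rule integrable_event) measurable
  have "(\<integral>\<omega>. q * indicator {\<omega>. B \<omega>} \<omega> \<partial>S) \<le> \<P>(\<omega> in S. B \<omega> \<and> E \<omega>)"
    unfolding prob_split(2)[OF assms(1-3)]
    using int le by (intro integral_mono prob_split(1) assms(1-3) integrable_mult_right int) (auto simp: indicator_def)
  thus ?thesis by simp
qed

end

section \<open>Second moments and the maximal inequality\<close>
lemma walk_comb_seq_Suc: "walk (comb_seq t \<omega> \<omega>') (Suc t) = walk \<omega> t + \<omega>' 0"
  by (simp add: walk_Suc walk_comb_seq_le comb_seq_def)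

primrec running_max :: "(nat \<Rightarrow> real) \<Rightarrow> nat \<Rightarrow> real" where
  "running_max \<omega> 0 = 0"
| "running_max \<omega> (Suc t) = max (running_max \<omega> t) \<bar>walk \<omega> (Suc t)\<bar>"

lemma running_max_nonneg: "0 \<le> running_max \<omega> t"
  by (induction t) (auto simp: max_def)

lemma abs_walk_le_running_max: "s \<le> t \<Longrightarrow> \<bar>walk \<omega> s\<bar> \<le> running_max \<omega> t"
  by (induction t) (auto simp: le_Suc_eq)

lemma running_max_comb_seq: "s \<le> t \<Longrightarrow> running_max (comb_seq t \<omega> \<omega>') s = running_max \<omega> s"
  by (induction s) (auto simp: walk_comb_seq_le)

text \<open>
  The pointwise inequality behind Doob's \<open>L\<^sup>2\<close> maximal inequality.  Let the walk step from \<open>w\<close> to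
  \<open>w + x\<close>, let \<open>m\<close> be the running maximum before the step, \<open>a = \<bar>w + x\<bar>\<close>, and \<open>v = \<bar>w\<bar> + sgn w * x\<close>, which
  is linear in \<open>x\<close>.  Then the inequality says that \<open>2 * m\<^sup>2 - 4 * m * \<bar>w\<bar>\<close> is a supermartingale.
\<close>
lemma doob_max_step:
  fixes a m v :: real
  assumes "v \<le> a" "0 \<le> m"
  shows "2 * (max m a)\<^sup>2 - 4 * max m a * a \<le> 2 * m\<^sup>2 - 4 * m * v"
proof -
  have "2 * (max m a)\<^sup>2 - 4 * max m a * a \<le> 2 * m\<^sup>2 - 4 * m * a"
    using zero_le_power2[of "m - a"] by (auto simp: max_def power2_eq_square algebra_simps)
  also have "\<dots> \<le> 2 * m\<^sup>2 - 4 * m * v" using assms by (simp add: mult_left_mono)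
  finally show ?thesis .
qed

context random_walk
begin

definition variance_step :: real where "variance_step = (\<integral>x. x\<^sup>2 \<partial>\<mu>)"

lemma variance_step_pos: "0 < variance_step"
  using nondegenerate by (simp add: variance_step_def)

lemma walk_square_integrable: "integrable S (\<lambda>\<omega>. (walk \<omega> t)\<^sup>2)"
proof (induction t)
  case (Suc t)
  have "integrable S (\<lambda>\<omega>. (\<omega> t)\<^sup>2)"
    by (rule integrable_coordinate[THEN iffD2]) (simp, rule square_integrable)
  with Suc have "integrable S (\<lambda>\<omega>. 2 * (walk \<omega> t)\<^sup>2 + 2 * (\<omega> t)\<^sup>2)" by simp
  thus ?case
  proof (rule Bochner_Integration.integrable_bound)
    show "AE \<omega> in S. norm ((walk \<omega> (Suc t))\<^sup>2) \<le> norm (2 * (walk \<omega> t)\<^sup>2 + 2 * (\<omega> t)\<^sup>2)"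
    proof (rule AE_I2)
      fix \<omega>
      have "(walk \<omega> t + \<omega> t)\<^sup>2 \<le> 2 * (walk \<omega> t)\<^sup>2 + 2 * (\<omega> t)\<^sup>2"
        using zero_le_power2[of "walk \<omega> t - \<omega> t"] by (simp add: power2_sum power2_diff)
      thus "norm ((walk \<omega> (Suc t))\<^sup>2) \<le> norm (2 * (walk \<omega> t)\<^sup>2 + 2 * (\<omega> t)\<^sup>2)"
        by (simp add: walk_Suc)
    qed
  qed measurable
qed simp

lemma walk_second_moment: "(\<integral>\<omega>. (walk \<omega> t)\<^sup>2 \<partial>S) \<le> t * variance_step"
proof (induction t)
  case (Suc t)
  have "(\<integral>\<omega>. - (walk \<omega> t)\<^sup>2 \<partial>S) + (\<integral>\<omega>. -1 \<partial>S) * (\<integral>x. x\<^sup>2 \<partial>\<mu>) \<le> (\<integral>\<omega>. - (walk \<omega> (Suc t))\<^sup>2 \<partial>S)"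
    by (rule expectation_step_ge[where t = t and b = "\<lambda>\<omega>. - 2 * walk \<omega> t"])
       (use walk_square_integrable square_integrable in
         \<open>simp_all add: walk_comb_seq_Suc power2_sum\<close>)
  with Suc show ?case by (simp add: variance_step_def algebra_simps)
qed simp

lemma walk_chebyshev:
  assumes "0 < a"
  shows "\<P>(\<omega> in S. a < \<bar>walk \<omega> t\<bar>) \<le> t * variance_step / a\<^sup>2"
proof -
  have "\<P>(\<omega> in S. a < \<bar>walk \<omega> t\<bar>) \<le> \<P>(\<omega> in S. a \<le> \<bar>walk \<omega> t\<bar>)"
    by (intro P.finite_measure_mono subsetI) (auto intro!: event_sets)
  also have "\<dots> \<le> (\<integral>\<omega>. (walk \<omega> t)\<^sup>2 \<partial>S) / a\<^sup>2"
    by (intro P.second_moment_method walk_square_integrable assms) measurable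
  also have "\<dots> \<le> t * variance_step / a\<^sup>2"
    by (intro divide_right_mono walk_second_moment) simp
  finally show ?thesis .
qed

lemma running_max_measurable [measurable]: "(\<lambda>\<omega>. running_max \<omega> t) \<in> borel_measurable S"
  by (induction t) simp_all

lemma running_max_square_integrable: "integrable S (\<lambda>\<omega>. (running_max \<omega> t)\<^sup>2)"
proof (induction t)
  case (Suc t)
  have "integrable S (\<lambda>\<omega>. (running_max \<omega> t)\<^sup>2 + (walk \<omega> (Suc t))\<^sup>2)"
    using Suc walk_square_integrable by simp
  thus ?case
    by (rule Bochner_Integration.integrable_bound) (auto simp: max_def intro!: AE_I2)
qed simp

text \<open>
  Doob's inequality: the square of the maximum exceeds four times the square of the last position by at
  most a quantity \<open>U\<close> of nonpositive expectation.
\<close>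
lemma running_max_second_moment: "(\<integral>\<omega>. (running_max \<omega> t)\<^sup>2 \<partial>S) \<le> 4 * t * variance_step"
proof -
  define U where "U t \<omega> = 2 * (running_max \<omega> t)\<^sup>2 - 4 * running_max \<omega> t * \<bar>walk \<omega> t\<bar>" for t \<omega>
  have U_int: "integrable S (U t)" for t
  proof (rule Bochner_Integration.integrable_bound)
    show "integrable S (\<lambda>\<omega>. 6 * (running_max \<omega> t)\<^sup>2)" using running_max_square_integrable by simp
    show "U t \<in> borel_measurable S" unfolding U_def by measurable
    show "AE \<omega> in S. norm (U t \<omega>) \<le> norm (6 * (running_max \<omega> t)\<^sup>2)"
    proof (rule AE_I2)
      fix \<omega>
      have "running_max \<omega> t * \<bar>walk \<omega> t\<bar> \<le> running_max \<omega> t * running_max \<omega> t"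
        "0 \<le> running_max \<omega> t * \<bar>walk \<omega> t\<bar>"
        using running_max_nonneg abs_walk_le_running_max by (auto intro!: mult_left_mono)
      thus "norm (U t \<omega>) \<le> norm (6 * (running_max \<omega> t)\<^sup>2)"
        by (simp add: U_def power2_eq_square abs_if)
    qed
  qed
  have U: "(\<integral>\<omega>. U t \<omega> \<partial>S) \<le> 0" for t
  proof (induction t)
    case 0
    show ?case by (simp add: U_def)
  next
    case (Suc t)
    have "(\<integral>\<omega>. - U t \<omega> \<partial>S) + (\<integral>\<omega>. 0 \<partial>S) * (\<integral>x. 0 \<partial>\<mu>) \<le> (\<integral>\<omega>. - U (Suc t) \<omega> \<partial>S)"
    proof (rule expectation_step_ge[where t = t and b = "\<lambda>\<omega>. 4 * running_max \<omega> t * sgn (walk \<omega> t)"])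
      fix \<omega> \<omega>' :: "nat \<Rightarrow> real"
      have "\<bar>walk \<omega> t\<bar> + sgn (walk \<omega> t) * \<omega>' 0 \<le> \<bar>walk \<omega> t + \<omega>' 0\<bar>"
        by (auto simp: sgn_if)
      from doob_max_step[OF this running_max_nonneg[of \<omega> t]]
      show "- U t \<omega> + 4 * running_max \<omega> t * sgn (walk \<omega> t) * \<omega>' 0 + 0 * 0 \<le> - U (Suc t) (comb_seq t \<omega> \<omega>')"
        by (simp add: U_def running_max_comb_seq walk_comb_seq_Suc algebra_simps)
    qed (use U_int in auto)
    with Suc show ?case by simp
  qed
  have "(running_max \<omega> t)\<^sup>2 \<le> 4 * (walk \<omega> t)\<^sup>2 + U t \<omega>" for \<omega>
    using zero_le_power2[of "running_max \<omega> t - 2 * \<bar>walk \<omega> t\<bar>"]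
    by (simp add: U_def power2_eq_square algebra_simps)
  hence "(\<integral>\<omega>. (running_max \<omega> t)\<^sup>2 \<partial>S) \<le> (\<integral>\<omega>. 4 * (walk \<omega> t)\<^sup>2 + U t \<omega> \<partial>S)"
    using U_int walk_square_integrable running_max_square_integrable by (intro integral_mono) auto
  also have "\<dots> = 4 * (\<integral>\<omega>. (walk \<omega> t)\<^sup>2 \<partial>S) + (\<integral>\<omega>. U t \<omega> \<partial>S)"
    using U_int walk_square_integrable by simp
  also have "\<dots> \<le> 4 * (t * variance_step) + 0" using U walk_second_moment by (intro add_mono mult_left_mono) auto
  finally show ?thesis by simp
qed

lemma running_max_integrable: "integrable S (\<lambda>\<omega>. running_max \<omega> t)"
  by (rule P.square_integrable_imp_integrable[OF _ running_max_square_integrable]) measurable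

lemma running_max_expectation: "(\<integral>\<omega>. running_max \<omega> t \<partial>S) \<le> 2 * sqrt (t * variance_step)"
proof (cases "t = 0")
  case False
  define c where "c = 2 * sqrt (t * variance_step)"
  have c: "0 < c" using False variance_step_pos by (simp add: c_def)
  \<comment> \<open>The inequality of the means, with the value of \<open>c\<close> that balances the two terms in expectation.\<close>
  have "running_max \<omega> t \<le> (running_max \<omega> t)\<^sup>2 / (2 * c) + c / 2" for \<omega>
  proof -
    have "2 * running_max \<omega> t * c \<le> (running_max \<omega> t)\<^sup>2 + c\<^sup>2"
      using zero_le_power2[of "running_max \<omega> t - c"] by (simp add: power2_diff)
    thus ?thesis using c by (simp add: field_simps power2_eq_square)
  qed
  hence "(\<integral>\<omega>. running_max \<omega> t \<partial>S) \<le> (\<integral>\<omega>. (running_max \<omega> t)\<^sup>2 / (2 * c) + c / 2 \<partial>S)"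
    using running_max_integrable running_max_square_integrable by (intro integral_mono) auto
  also have "\<dots> = (\<integral>\<omega>. (running_max \<omega> t)\<^sup>2 \<partial>S) / (2 * c) + c / 2"
    using running_max_square_integrable by simp
  also have "\<dots> \<le> 4 * t * variance_step / (2 * c) + c / 2"
    using c running_max_second_moment by (intro add_right_mono divide_right_mono) auto
  also have "4 * t * variance_step = c\<^sup>2" using variance_step_pos by (simp add: c_def power_mult_distrib)
  also have "c\<^sup>2 / (2 * c) + c / 2 = c" using c by (simp add: power2_eq_square)
  finally show ?thesis by (simp add: c_def)
qed simp

end

section \<open>Expected occupation time of a strip\<close>

definition clamp_to :: "real \<Rightarrow> real \<Rightarrow> real" where
  "clamp_to \<rho> y = max (- \<rho>) (min \<rho> y)"

text \<open>
  The Huber function is \<open>y\<^sup>2 / 2\<close> on \<open>{-\<rho>..\<rho>}\<close> and continues linearly with slopes \<open>-\<rho>\<close> and \<open>\<rho>\<close>.  It is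
  the maximum of its tangents \<open>c * y - c\<^sup>2 / 2\<close> over \<open>\<bar>c\<bar> \<le> \<rho>\<close>, attained at \<open>c = clamp_to \<rho> y\<close>; this form
  gives convexity and the Lipschitz bound from one inequality.
\<close>
definition huber :: "real \<Rightarrow> real \<Rightarrow> real" where
  "huber \<rho> y = clamp_to \<rho> y * y - (clamp_to \<rho> y)\<^sup>2 / 2"

lemma abs_clamp_to: "0 \<le> \<rho> \<Longrightarrow> \<bar>clamp_to \<rho> y\<bar> \<le> \<rho>"
  by (auto simp: clamp_to_def)

lemma huber_ge_line:
  assumes "\<bar>c\<bar> \<le> \<rho>"
  shows "c * z - c\<^sup>2 / 2 \<le> huber \<rho> z"
proof -
  consider "\<bar>z\<bar> \<le> \<rho>" | "\<rho> < z" | "z < - \<rho>" by linarith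
  thus ?thesis
  proof cases
    case 1
    hence "clamp_to \<rho> z = z" by (auto simp: clamp_to_def)
    thus ?thesis using zero_le_power2[of "z - c"] by (simp add: huber_def power2_eq_square algebra_simps)
  next
    case 2
    hence "clamp_to \<rho> z = \<rho>" using assms by (auto simp: clamp_to_def)
    moreover have "0 \<le> (\<rho> - c) * (z - (\<rho> + c) / 2)" using assms 2 by (intro mult_nonneg_nonneg) auto
    ultimately show ?thesis by (simp add: huber_def power2_eq_square field_simps)
  next
    case 3
    hence "clamp_to \<rho> z = - \<rho>" using assms by (auto simp: clamp_to_def)
    moreover have "0 \<le> (\<rho> + c) * (- z - (\<rho> - c) / 2)" using assms 3 by (intro mult_nonneg_nonneg) auto
    ultimately show ?thesis by (simp add: huber_def power2_eq_square field_simps)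
  qed
qed

lemma huber_nonneg: "0 \<le> \<rho> \<Longrightarrow> 0 \<le> huber \<rho> y"
  using huber_ge_line[of 0 \<rho> y] by simp

lemma huber_convex: "0 \<le> \<rho> \<Longrightarrow> huber \<rho> y + clamp_to \<rho> y * x \<le> huber \<rho> (y + x)"
  using huber_ge_line[OF abs_clamp_to, of \<rho> y "y + x"] by (simp add: huber_def algebra_simps)

lemma huber_lipschitz:
  assumes "0 \<le> \<rho>" shows "huber \<rho> (x + w) \<le> huber \<rho> x + \<rho> * \<bar>w\<bar>"
proof -
  have "huber \<rho> (x + w) \<le> huber \<rho> x + clamp_to \<rho> (x + w) * w"
    using huber_ge_line[OF abs_clamp_to[OF assms], of "x + w" x] by (simp add: huber_def algebra_simps)
  also have "clamp_to \<rho> (x + w) * w \<le> \<bar>clamp_to \<rho> (x + w)\<bar> * \<bar>w\<bar>" by (simp flip: abs_mult)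
  also have "\<dots> \<le> \<rho> * \<bar>w\<bar>" using abs_clamp_to[OF assms] by (intro mult_right_mono) auto
  finally show ?thesis by simp
qed

lemma huber_square: "\<bar>y\<bar> \<le> \<rho> \<Longrightarrow> huber \<rho> y = y\<^sup>2 / 2"
proof -
  assume "\<bar>y\<bar> \<le> \<rho>"
  hence "clamp_to \<rho> y = y" by (auto simp: clamp_to_def)
  thus ?thesis by (simp add: huber_def power2_eq_square)
qed

text \<open>
  Convexity gives the drift term that is linear in the step \<open>x\<close>.  If \<open>y\<close> lies in the strip and the step is
  at most \<open>R\<close>, both points are in the quadratic zone and the step contributes \<open>x\<^sup>2 / 2\<close> in addition.
\<close>
lemma huber_step:
  assumes "0 \<le> h" "0 \<le> R"
  shows "huber (h + R) y + clamp_to (h + R) y * x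
      + indicator {y. \<bar>y\<bar> \<le> h} y * (x\<^sup>2 / 2 * indicator {x. \<bar>x\<bar> \<le> R} x) \<le> huber (h + R) (y + x)"
proof (cases "\<bar>y\<bar> \<le> h \<and> \<bar>x\<bar> \<le> R")
  case True
  hence "clamp_to (h + R) y = y" using assms by (auto simp: clamp_to_def)
  moreover have "huber (h + R) y = y\<^sup>2 / 2" "huber (h + R) (y + x) = (y + x)\<^sup>2 / 2"
    using True assms by (intro huber_square; linarith)+
  ultimately show ?thesis using True by (simp add: power2_eq_square algebra_simps)
next
  case False
  thus ?thesis using huber_convex[of "h + R" y x] assms by (auto simp: indicator_def)
qed

context random_walk
begin

lemma truncated_second_moment_pos: "\<exists>R > 0. 0 < (\<integral>x. x\<^sup>2 / 2 * indicator {x. \<bar>x\<bar> \<le> R} x \<partial>\<mu>)"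
proof -
  have "(\<lambda>n. \<integral>x. x\<^sup>2 / 2 * indicator {x. \<bar>x\<bar> \<le> real n} x \<partial>\<mu>) \<longlonglongrightarrow> (\<integral>x. x\<^sup>2 / 2 \<partial>\<mu>)"
  proof (rule integral_dominated_convergence[where w = "\<lambda>x. x\<^sup>2 / 2"])
    show "integrable \<mu> (\<lambda>x. x\<^sup>2 / 2)" using square_integrable by simp
    show "AE x in \<mu>. (\<lambda>n. x\<^sup>2 / 2 * indicator {x. \<bar>x\<bar> \<le> real n} x) \<longlonglongrightarrow> x\<^sup>2 / 2"
    proof (rule AE_I2)
      fix x :: real
      have "eventually (\<lambda>n. \<bar>x\<bar> \<le> real n) sequentially"
        using real_arch_simple[of "\<bar>x\<bar>"] by (meson eventually_sequentiallyI of_nat_mono order_trans)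
      thus "(\<lambda>n. x\<^sup>2 / 2 * indicator {x. \<bar>x\<bar> \<le> real n} x) \<longlonglongrightarrow> x\<^sup>2 / 2"
        by (intro tendsto_eventually) (erule eventually_mono, simp)
    qed
    show "(\<lambda>x. x\<^sup>2 / 2 * indicator {x. \<bar>x\<bar> \<le> real n} x) \<in> borel_measurable \<mu>" for n
      unfolding measurable_cong_sets[OF sets_step refl] by measurable
  qed (auto intro!: AE_I2 simp: indicator_def measurable_cong_sets[OF sets_step refl])
  moreover have "0 < (\<integral>x. x\<^sup>2 / 2 \<partial>\<mu>)" using nondegenerate by simp
  ultimately have "eventually (\<lambda>n. 0 < (\<integral>x. x\<^sup>2 / 2 * indicator {x. \<bar>x\<bar> \<le> real n} x \<partial>\<mu>)) sequentially"
    by (rule order_tendstoD(1))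
  hence "eventually (\<lambda>n. 0 < (\<integral>x. x\<^sup>2 / 2 * indicator {x. \<bar>x\<bar> \<le> real n} x \<partial>\<mu>) \<and> 0 < n) sequentially"
    using eventually_gt_at_top by (rule eventually_conj)
  then obtain n :: nat where "0 < (\<integral>x. x\<^sup>2 / 2 * indicator {x. \<bar>x\<bar> \<le> real n} x \<partial>\<mu>)" "0 < n"
    using eventually_happens by force
  thus ?thesis by (intro exI[of _ "real n"]) simp
qed

text \<open>
  By \<open>huber_step\<close> with \<open>\<rho> = h + R\<close>, the expectation of the Huber function grows by a fixed amount for
  each unit of expected time in the strip, while its total growth is at most \<open>\<rho>\<close> times the expected
  displacement.
\<close>
lemma occupation_bound:
  "\<exists>R > 0. \<exists>C > 0. \<forall>x h T. 0 \<le> h \<longrightarrow>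
     (\<Sum>t<T. \<P>(\<omega> in S. \<bar>x + walk \<omega> t\<bar> \<le> h)) \<le> C * (h + R) * sqrt T"
proof -
  obtain R where R: "0 < R" and c: "0 < (\<integral>x. x\<^sup>2 / 2 * indicator {x. \<bar>x\<bar> \<le> R} x \<partial>\<mu>)" (is "0 < ?c")
    using truncated_second_moment_pos by blast
  show ?thesis
  proof (rule exI[of _ R], rule conjI[OF R], rule exI[of _ "2 * sqrt variance_step / ?c"], intro conjI allI impI)
    show "0 < 2 * sqrt variance_step / ?c" using c variance_step_pos by simp
    fix x h :: real and T :: nat assume h: "0 \<le> h"
    define g where "g = huber (h + R)"
    have \<rho>: "0 \<le> h + R" using h R by simp
    have g_measurable [measurable]: "g \<in> borel_measurable borel"
      unfolding g_def huber_def clamp_to_def by measurable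
    have g_int: "integrable S (\<lambda>\<omega>. g (x + walk \<omega> t))" for t
    proof (rule Bochner_Integration.integrable_bound)
      show "integrable S (\<lambda>\<omega>. g x + (h + R) * running_max \<omega> t)" using running_max_integrable by simp
      show "AE \<omega> in S. norm (g (x + walk \<omega> t)) \<le> norm (g x + (h + R) * running_max \<omega> t)"
      proof (rule AE_I2)
        fix \<omega>
        have "g (x + walk \<omega> t) \<le> g x + (h + R) * \<bar>walk \<omega> t\<bar>" unfolding g_def by (rule huber_lipschitz[OF \<rho>])
        also have "\<dots> \<le> g x + (h + R) * running_max \<omega> t"
          using \<rho> abs_walk_le_running_max by (intro add_left_mono mult_left_mono) auto
        finally show "norm (g (x + walk \<omega> t)) \<le> norm (g x + (h + R) * running_max \<omega> t)"
          using huber_nonneg[OF \<rho>] by (simp add: g_def)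
      qed
    qed measurable
    have q: "integrable \<mu> (\<lambda>x. x\<^sup>2 / 2 * indicator {x. \<bar>x\<bar> \<le> R} x)"
    proof (rule Bochner_Integration.integrable_bound[OF square_integrable])
      show "(\<lambda>x. x\<^sup>2 / 2 * indicator {x. \<bar>x\<bar> \<le> R} x) \<in> borel_measurable \<mu>"
        unfolding measurable_cong_sets[OF sets_step refl] by measurable
    qed (auto intro!: AE_I2 simp: indicator_def)
    have "g x + (\<Sum>t<T. \<P>(\<omega> in S. \<bar>x + walk \<omega> t\<bar> \<le> h)) * ?c \<le> (\<integral>\<omega>. g (x + walk \<omega> T) \<partial>S)"
    proof (induction T)
      case (Suc T)
      have ev: "Measurable.pred S (\<lambda>\<omega>. \<bar>x + walk \<omega> T\<bar> \<le> h)" by measurable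
      have "(\<integral>\<omega>. g (x + walk \<omega> T) \<partial>S) + (\<integral>\<omega>. indicator {\<omega>. \<bar>x + walk \<omega> T\<bar> \<le> h} \<omega> \<partial>S) * ?c
          \<le> (\<integral>\<omega>. g (x + walk \<omega> (Suc T)) \<partial>S)"
      proof (rule expectation_step_ge[where t = T and b = "\<lambda>\<omega>. clamp_to (h + R) (x + walk \<omega> T)"])
        show "integrable S (indicator {\<omega>. \<bar>x + walk \<omega> T\<bar> \<le> h} :: _ \<Rightarrow> real)" by (rule integrable_event[OF ev])
        fix \<omega> \<omega>' :: "nat \<Rightarrow> real"
        show "g (x + walk \<omega> T) + clamp_to (h + R) (x + walk \<omega> T) * \<omega>' 0
            + indicator {\<omega>. \<bar>x + walk \<omega> T\<bar> \<le> h} \<omega> * ((\<omega>' 0)\<^sup>2 / 2 * indicator {x. \<bar>x\<bar> \<le> R} (\<omega>' 0))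
            \<le> g (x + walk (comb_seq T \<omega> \<omega>') (Suc T))"
          using huber_step[OF h less_imp_le[OF R], of "x + walk \<omega> T" "\<omega>' 0"]
          by (simp add: g_def walk_comb_seq_Suc indicator_def add.assoc)
      qed (rule g_int q)+
      moreover have "(\<integral>\<omega>. indicator {\<omega>. \<bar>x + walk \<omega> T\<bar> \<le> h} \<omega> \<partial>S) = \<P>(\<omega> in S. \<bar>x + walk \<omega> T\<bar> \<le> h)"
        by simp
      ultimately show ?case using Suc by (simp add: distrib_right add_divide_distrib)
    qed simp
    also have "\<dots> \<le> (\<integral>\<omega>. g x + (h + R) * running_max \<omega> T \<partial>S)"
    proof (intro integral_mono g_int)
      fix \<omega>
      have "g (x + walk \<omega> T) \<le> g x + (h + R) * \<bar>walk \<omega> T\<bar>" unfolding g_def by (rule huber_lipschitz[OF \<rho>])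
      also have "\<dots> \<le> g x + (h + R) * running_max \<omega> T"
        using \<rho> abs_walk_le_running_max by (intro add_left_mono mult_left_mono) auto
      finally show "g (x + walk \<omega> T) \<le> g x + (h + R) * running_max \<omega> T" .
    qed (use running_max_integrable in simp)
    also have "\<dots> = g x + (h + R) * (\<integral>\<omega>. running_max \<omega> T \<partial>S)" using running_max_integrable by simp
    also have "\<dots> \<le> g x + (h + R) * (2 * sqrt (T * variance_step))"
      using \<rho> running_max_expectation by (intro add_left_mono mult_left_mono)
    finally show "(\<Sum>t<T. \<P>(\<omega> in S. \<bar>x + walk \<omega> t\<bar> \<le> h)) \<le> 2 * sqrt variance_step / ?c * (h + R) * sqrt T"
      using c by (simp add: real_sqrt_mult field_simps)
  qed
qed

end

section \<open>Number of blocks in which a strip is visited\<close>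
definition hits :: "real \<Rightarrow> nat \<Rightarrow> nat \<Rightarrow> (nat \<Rightarrow> real) \<Rightarrow> bool" where
  "hits x m j \<omega> \<longleftrightarrow> (\<exists>t. t div m = j \<and> \<bar>x + walk \<omega> t\<bar> \<le> sqrt m)"

definition visits :: "real \<Rightarrow> nat \<Rightarrow> nat \<Rightarrow> (nat \<Rightarrow> real) \<Rightarrow> nat" where
  "visits x m r \<omega> = (\<Sum>j<r. of_bool (hits x m j \<omega>))"

lemma block_iff: "0 < m \<Longrightarrow> t div m = j \<longleftrightarrow> t \<in> {j * m..<Suc j * m}" for t m j :: nat
  by (metis atLeastLessThan_iff div_nat_eqI dividend_less_times_div less_eq_div_iff_mult_less_eq
      div_less_iff_less_mult less_Suc_eq_le order_antisym order_refl lessI mult.commute)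

lemma hits_iff: "0 < m \<Longrightarrow> hits x m j \<omega> \<longleftrightarrow> (\<exists>t\<in>{j * m..<Suc j * m}. \<bar>x + walk \<omega> t\<bar> \<le> sqrt m)"
  unfolding hits_def using block_iff by metis

lemma hits_comb_seq_past:
  assumes "0 < m" "Suc j * m \<le> t"
  shows "hits x m j (comb_seq t \<omega> \<omega>') \<longleftrightarrow> hits x m j \<omega>"
  unfolding hits_iff[OF assms(1)] using assms(2) by (intro bex_cong refl) (simp add: walk_comb_seq_le)

lemma hits_comb_seq_future:
  assumes "0 < m"
  shows "hits x m (k + j) (comb_seq (k * m) \<omega> \<omega>') \<longleftrightarrow> hits (x + walk \<omega> (k * m)) m j \<omega>'"
proof
  assume "hits x m (k + j) (comb_seq (k * m) \<omega> \<omega>')"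
  then obtain t where t: "t div m = k + j" "\<bar>x + walk (comb_seq (k * m) \<omega> \<omega>') t\<bar> \<le> sqrt m"
    by (auto simp: hits_def)
  have "k * m \<le> t" using t(1) assms by (metis div_times_less_eq_dividend le_add1 mult_le_mono1 order_trans)
  then obtain s where s: "t = k * m + s" using le_Suc_ex by blast
  have "s div m = j" using t(1) assms by (simp add: s)
  thus "hits (x + walk \<omega> (k * m)) m j \<omega>'"
    using t(2) unfolding hits_def s walk_comb_seq_add by (auto simp: add.assoc)
next
  assume "hits (x + walk \<omega> (k * m)) m j \<omega>'"
  then obtain s where "s div m = j" "\<bar>x + walk \<omega> (k * m) + walk \<omega>' s\<bar> \<le> sqrt m"
    by (auto simp: hits_def)
  thus "hits x m (k + j) (comb_seq (k * m) \<omega> \<omega>')"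
    using assms unfolding hits_def by (intro exI[of _ "k * m + s"]) (simp add: walk_comb_seq_add add.assoc)
qed

text \<open>
  Windows of two consecutive blocks cover every time at most twice.
\<close>
lemma sum_blocks_le:
  fixes f :: "nat \<Rightarrow> real"
  assumes "\<And>t. 0 \<le> f t"
  shows "(\<Sum>j<r. \<Sum>t\<in>{j * m..<Suc (Suc j) * m}. f t) \<le> 2 * (\<Sum>t<Suc r * m. f t)"
proof -
  have blocks: "(\<Sum>j<k. \<Sum>t\<in>{j * m..<Suc j * m}. f t) = (\<Sum>t<k * m. f t)" for k
    using sum.nat_group[of f m k] by (simp add: add.commute)
  have shifted: "(\<Sum>j<r. \<Sum>t\<in>{Suc j * m..<Suc (Suc j) * m}. f t) \<le> (\<Sum>t<Suc r * m. f t)"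
  proof -
    have "(\<Sum>j<r. \<Sum>t\<in>{Suc j * m..<Suc (Suc j) * m}. f t)
        \<le> (\<Sum>t\<in>{0 * m..<Suc 0 * m}. f t) + (\<Sum>j<r. \<Sum>t\<in>{Suc j * m..<Suc (Suc j) * m}. f t)"
      using assms by (intro le_add_same_cancel2[THEN iffD2] sum_nonneg)
    also have "\<dots> = (\<Sum>j<Suc r. \<Sum>t\<in>{j * m..<Suc j * m}. f t)"
      by (rule sum.lessThan_Suc_shift[symmetric])
    finally show ?thesis by (simp only: blocks)
  qed
  have "(\<Sum>j<r. \<Sum>t\<in>{j * m..<Suc (Suc j) * m}. f t)
      = (\<Sum>j<r. \<Sum>t\<in>{j * m..<Suc j * m}. f t) + (\<Sum>j<r. \<Sum>t\<in>{Suc j * m..<Suc (Suc j) * m}. f t)"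
    unfolding sum.distrib[symmetric] by (intro sum.cong refl sum.atLeastLessThan_concat[symmetric]) simp_all
  also have "(\<Sum>j<r. \<Sum>t\<in>{j * m..<Suc j * m}. f t) \<le> (\<Sum>t<Suc r * m. f t)"
    unfolding blocks using assms by (intro sum_mono2) auto
  finally show ?thesis using shifted by simp
qed

context random_walk
begin

lemma hits_measurable [measurable]: "Measurable.pred S (hits x m j)"
  unfolding hits_def by measurable

text \<open>
  From the first time the strip is hit within block \<open>j\<close>, each of the next \<open>m\<close> positions is, by Chebyshev,
  within \<open>sqrt (2 * variance_step * m)\<close> of the hitting point with probability at least \<open>1/2\<close>.  So a
  visited block contributes on average at least \<open>m / 2\<close> to the occupation time of the wider strip,
  during this block and the next one.
\<close>
lemma occupation_after_hit:
  assumes m: "0 < m"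
  defines "h \<equiv> (1 + sqrt (2 * variance_step)) * sqrt m"
  shows "m / 2 * \<P>(\<omega> in S. hits x m j \<omega>)
     \<le> (\<Sum>t\<in>{j * m..<Suc (Suc j) * m}. \<P>(\<omega> in S. \<bar>x + walk \<omega> t\<bar> \<le> h))"
proof -
  define first where "first t \<omega> \<longleftrightarrow> \<bar>x + walk \<omega> t\<bar> \<le> sqrt m \<and> (\<forall>s\<in>{j * m..<t}. \<not> \<bar>x + walk \<omega> s\<bar> \<le> sqrt m)" for t \<omega>
  define near where "near t \<omega> \<longleftrightarrow> \<bar>x + walk \<omega> t\<bar> \<le> h" for t \<omega>
  have [measurable]: "Measurable.pred S (first t)" "Measurable.pred S (near t)" for t
    unfolding first_def near_def by measurable
  have first_sets: "{\<omega>. first t \<omega>} \<in> sets S" "{\<omega>. first t \<omega> \<and> near s \<omega>} \<in> sets S" for s t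
    by (auto intro!: event_sets)
  have disj: "s = t" if "first s \<omega>" "first t \<omega>" "s \<in> {j * m..<Suc j * m}" "t \<in> {j * m..<Suc j * m}" for s t \<omega>
    using that unfolding first_def by (metis atLeastLessThan_iff linorder_neqE_nat)
  have stay: "1 / 2 * \<P>(\<omega> in S. first t \<omega>) \<le> \<P>(\<omega> in S. first t \<omega> \<and> near (t + s) \<omega>)" if s: "s < m" for s t
  proof (rule markov_ge[where t = t])
    fix \<omega> \<omega>' show "first t (comb_seq t \<omega> \<omega>') \<longleftrightarrow> first t \<omega>"
      by (auto simp: first_def walk_comb_seq_le)
  next
    fix \<omega> assume first: "first t \<omega>"
    define a where "a = sqrt (2 * variance_step) * sqrt m"
    have a: "0 < a" "a\<^sup>2 = 2 * variance_step * m"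
      using m variance_step_pos by (auto simp: a_def power_mult_distrib)
    have "\<P>(\<omega>' in S. a < \<bar>walk \<omega>' s\<bar>) \<le> s * variance_step / a\<^sup>2" by (rule walk_chebyshev) fact
    also have "\<dots> \<le> 1 / 2" using a(2) s m variance_step_pos by (simp add: divide_simps)
    finally have "1 / 2 \<le> 1 - \<P>(\<omega>' in S. a < \<bar>walk \<omega>' s\<bar>)" by simp
    also have "\<dots> = \<P>(\<omega>' in S. \<not> a < \<bar>walk \<omega>' s\<bar>)"
      by (intro P.prob_neg[symmetric]) measurable
    also have "\<dots> \<le> \<P>(\<omega>' in S. near (t + s) (comb_seq t \<omega> \<omega>'))"
    proof (rule P.finite_measure_mono)
      show "{\<omega>' \<in> space S. \<not> a < \<bar>walk \<omega>' s\<bar>} \<subseteq> {\<omega>' \<in> space S. near (t + s) (comb_seq t \<omega> \<omega>')}"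
      proof safe
        fix \<omega>' assume "\<not> a < \<bar>walk \<omega>' s\<bar>"
        moreover have "\<bar>x + walk \<omega> t\<bar> \<le> sqrt m" using first by (simp add: first_def)
        moreover have "h = sqrt m + a" by (simp add: h_def a_def algebra_simps)
        ultimately show "near (t + s) (comb_seq t \<omega> \<omega>')"
          unfolding near_def walk_comb_seq_add by linarith
      qed
      show "{\<omega>' \<in> space S. near (t + s) (comb_seq t \<omega> \<omega>')} \<in> sets S"
        unfolding near_def walk_comb_seq_add by measurable
    qed
    finally show "1 / 2 \<le> \<P>(\<omega>' in S. near (t + s) (comb_seq t \<omega> \<omega>'))" .
  qed measurable
  have first_sum: "(\<Sum>t\<in>{j * m..<Suc j * m}. \<P>(\<omega> in S. first t \<omega> \<and> near u \<omega>)) \<le> \<P>(\<omega> in S. near u \<omega>)" for u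
  proof -
    have "(\<Sum>t\<in>{j * m..<Suc j * m}. measure S {\<omega>. first t \<omega> \<and> near u \<omega>})
        = measure S (\<Union>t\<in>{j * m..<Suc j * m}. {\<omega>. first t \<omega> \<and> near u \<omega>})"
      using disj first_sets
      by (intro P.finite_measure_finite_Union[symmetric]) (auto simp: disjoint_family_on_def)
    also have "\<dots> \<le> measure S {\<omega>. near u \<omega>}" by (intro P.finite_measure_mono event_sets) auto
    finally show ?thesis by simp
  qed
  have hit_first: "\<P>(\<omega> in S. hits x m j \<omega>) \<le> (\<Sum>t\<in>{j * m..<Suc j * m}. \<P>(\<omega> in S. first t \<omega>))"
  proof -
    have "\<exists>t\<in>{j * m..<Suc j * m}. first t \<omega>" if "hits x m j \<omega>" for \<omega>
    proof -
      define t where "t = (LEAST t. t \<in> {j * m..<Suc j * m} \<and> \<bar>x + walk \<omega> t\<bar> \<le> sqrt m)"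
      have t: "t \<in> {j * m..<Suc j * m} \<and> \<bar>x + walk \<omega> t\<bar> \<le> sqrt m"
        using that unfolding hits_iff[OF m] t_def by - (rule LeastI_ex, blast)
      moreover have "\<not> \<bar>x + walk \<omega> s\<bar> \<le> sqrt m" if "s \<in> {j * m..<t}" for s
      proof -
        have "s < t" "s \<in> {j * m..<Suc j * m}" using that t by auto
        thus ?thesis using not_less_Least[of s] unfolding t_def by blast
      qed
      ultimately have "first t \<omega>" by (simp add: first_def)
      with t show ?thesis by blast
    qed
    hence "measure S {\<omega>. hits x m j \<omega>} \<le> measure S (\<Union>t\<in>{j * m..<Suc j * m}. {\<omega>. first t \<omega>})"
      using first_sets by (intro P.finite_measure_mono) auto
    also have "\<dots> \<le> (\<Sum>t\<in>{j * m..<Suc j * m}. measure S {\<omega>. first t \<omega>})"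
      using first_sets by (intro P.finite_measure_subadditive_finite) auto
    finally show ?thesis by simp
  qed
  have "m / 2 * \<P>(\<omega> in S. hits x m j \<omega>) \<le> m / 2 * (\<Sum>t\<in>{j * m..<Suc j * m}. \<P>(\<omega> in S. first t \<omega>))"
    using hit_first by (intro mult_left_mono) auto
  also have "\<dots> = (\<Sum>t\<in>{j * m..<Suc j * m}. \<Sum>s<m. 1 / 2 * \<P>(\<omega> in S. first t \<omega>))"
    by (simp add: sum_distrib_left)
  also have "\<dots> \<le> (\<Sum>t\<in>{j * m..<Suc j * m}. \<Sum>s<m. \<P>(\<omega> in S. first t \<omega> \<and> near (t + s) \<omega>))"
    using stay by (intro sum_mono) auto
  also have "\<dots> \<le> (\<Sum>t\<in>{j * m..<Suc j * m}. \<Sum>u\<in>{j * m..<Suc (Suc j) * m}. \<P>(\<omega> in S. first t \<omega> \<and> near u \<omega>))"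
  proof (rule sum_mono)
    fix t assume t: "t \<in> {j * m..<Suc j * m}"
    have "(\<Sum>s<m. \<P>(\<omega> in S. first t \<omega> \<and> near (t + s) \<omega>)) = (\<Sum>u\<in>(+) t ` {..<m}. \<P>(\<omega> in S. first t \<omega> \<and> near u \<omega>))"
      by (simp add: sum.reindex)
    also have "\<dots> \<le> (\<Sum>u\<in>{j * m..<Suc (Suc j) * m}. \<P>(\<omega> in S. first t \<omega> \<and> near u \<omega>))"
      using t by (intro sum_mono2) auto
    finally show "(\<Sum>s<m. \<P>(\<omega> in S. first t \<omega> \<and> near (t + s) \<omega>)) \<le> \<dots>" .
  qed
  also have "\<dots> = (\<Sum>u\<in>{j * m..<Suc (Suc j) * m}. \<Sum>t\<in>{j * m..<Suc j * m}. \<P>(\<omega> in S. first t \<omega> \<and> near u \<omega>))"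
    by (rule sum.swap)
  also have "\<dots> \<le> (\<Sum>u\<in>{j * m..<Suc (Suc j) * m}. \<P>(\<omega> in S. near u \<omega>))"
    by (intro sum_mono first_sum)
  finally show ?thesis by (simp add: near_def)
qed

text \<open>
  The factors \<open>m\<close> cancel: strips of height \<open>sqrt m\<close> and blocks of length \<open>m\<close> are matched by
  diffusive scaling, so the bound depends on the number \<open>r\<close> of blocks only.
\<close>
lemma expected_visits_bound:
  "\<exists>C > 0. \<forall>x m r. 0 < m \<longrightarrow> 0 < r \<longrightarrow> (\<Sum>j<r. \<P>(\<omega> in S. hits x m j \<omega>)) \<le> C * sqrt r"
proof -
  obtain R C where RC: "0 < R" "0 < C" and occ: "\<And>x h T. 0 \<le> h \<Longrightarrow>
     (\<Sum>t<T. \<P>(\<omega> in S. \<bar>x + walk \<omega> t\<bar> \<le> h)) \<le> C * (h + R) * sqrt T"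
    using occupation_bound by meson
  define \<kappa> where "\<kappa> = 1 + sqrt (2 * variance_step)"
  have \<kappa>: "0 < \<kappa>" using variance_step_pos by (simp add: \<kappa>_def add_pos_nonneg)
  show ?thesis
  proof (rule exI[of _ "8 * C * (\<kappa> + R)"], intro conjI allI impI)
    show "0 < 8 * C * (\<kappa> + R)" using RC \<kappa> by simp
    fix x :: real and m r :: nat assume m: "0 < m" and r: "0 < r"
    define h where "h = \<kappa> * sqrt m"
    have "m / 2 * (\<Sum>j<r. \<P>(\<omega> in S. hits x m j \<omega>))
        \<le> (\<Sum>j<r. \<Sum>t\<in>{j * m..<Suc (Suc j) * m}. \<P>(\<omega> in S. \<bar>x + walk \<omega> t\<bar> \<le> h))"
      unfolding sum_distrib_left h_def \<kappa>_def by (intro sum_mono occupation_after_hit m)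
    also have "\<dots> \<le> 2 * (\<Sum>t<Suc r * m. \<P>(\<omega> in S. \<bar>x + walk \<omega> t\<bar> \<le> h))"
      by (intro sum_blocks_le) simp
    also have "\<dots> \<le> 2 * (C * (h + R) * sqrt (Suc r * m))"
      using \<kappa> by (intro mult_left_mono occ) (simp_all add: h_def)
    also have "\<dots> \<le> 2 * (C * ((\<kappa> + R) * sqrt m) * (2 * sqrt r * sqrt m))"
    proof -
      have "R * 1 \<le> R * sqrt m" using RC m by (intro mult_left_mono) auto
      hence 1: "h + R \<le> (\<kappa> + R) * sqrt m" by (simp add: h_def algebra_simps)
      have "Suc r * m \<le> 4 * r * m" using r by (intro mult_le_mono1) simp
      hence "sqrt (Suc r * m) \<le> sqrt (real (4 * r * m))" by (simp only: real_sqrt_le_iff of_nat_le_iff)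
      also have "\<dots> = 2 * sqrt r * sqrt m" by (simp add: real_sqrt_mult)
      finally have 2: "sqrt (Suc r * m) \<le> 2 * sqrt r * sqrt m" .
      show ?thesis using 1 2 RC \<kappa> by (intro mult_left_mono mult_mono) (auto simp: h_def)
    qed
    also have "\<dots> = m / 2 * (8 * C * (\<kappa> + R) * sqrt r)" using m by simp
    finally show "(\<Sum>j<r. \<P>(\<omega> in S. hits x m j \<omega>)) \<le> 8 * C * (\<kappa> + R) * sqrt r"
      using m by simp
  qed
qed

end

section \<open>Geometric tail for the number of visited blocks\<close>
lemma visits_mono: "r \<le> r' \<Longrightarrow> visits x m r \<omega> \<le> visits x m r' \<omega>"
  unfolding visits_def by (intro sum_mono2) auto

lemma visits_comb_seq:
  assumes "0 < m"
  shows "visits x m (a + b) (comb_seq (a * m) \<omega> \<omega>') = visits x m a \<omega> + visits (x + walk \<omega> (a * m)) m b \<omega>'"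
proof (induction b)
  case 0
  have "hits x m j (comb_seq (a * m) \<omega> \<omega>') \<longleftrightarrow> hits x m j \<omega>" if "j < a" for j
    using that assms by (intro hits_comb_seq_past mult_le_mono1) auto
  thus ?case by (simp add: visits_def)
next
  case (Suc b)
  thus ?case using hits_comb_seq_future[OF assms] by (simp add: visits_def)
qed

text \<open>
  The block \<open>j\<close> is the \<open>L\<close>-th visited one.
\<close>
lemma visits_crossing:
  assumes "L \<le> visits x m r \<omega>" "0 < L"
  shows "\<exists>j<r. visits x m j \<omega> < L \<and> L \<le> visits x m (Suc j) \<omega>"
  using assms
proof (induction r)
  case 0
  thus ?case by (simp add: visits_def)
next
  case (Suc r)
  thus ?case by (cases "L \<le> visits x m r \<omega>") (auto simp: less_Suc_eq)
qed

lemma returns_walk: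
  "returns (walk \<omega>) r m a = (\<Sum>i<r. of_bool (hits (- walk \<omega> a) m (Suc (a div m) + i) \<omega>))"
proof -
  have "{j. a div m < j \<and> j \<le> a div m + r \<and> (\<exists>t. t div m = j \<and> \<bar>walk \<omega> t - walk \<omega> a\<bar> \<le> sqrt m)}
      = (\<lambda>i. Suc (a div m) + i) ` ({..<r} \<inter> {i. hits (- walk \<omega> a) m (Suc (a div m) + i) \<omega>})"
    (is "?A = ?f ` ?B")
  proof (intro set_eqI iffI)
    fix j assume "j \<in> ?A"
    hence "j = ?f (j - Suc (a div m))" "j - Suc (a div m) \<in> ?B"
      by (auto simp: hits_def algebra_simps)
    thus "j \<in> ?f ` ?B" by (rule image_eqI)
  qed (auto simp: hits_def algebra_simps)
  thus ?thesis unfolding returns_def by (simp add: card_image inj_on_def)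
qed

lemma returns_comb_seq:
  fixes a m :: nat
  assumes "0 < m"
  defines "k \<equiv> Suc (a div m)"
  shows "returns (walk (comb_seq (k * m) \<omega> \<omega>')) r m a = visits (walk \<omega> (k * m) - walk \<omega> a) m r \<omega>'"
proof -
  have "a \<le> k * m" unfolding k_def using dividend_less_times_div[OF assms(1), of a] by (simp add: algebra_simps)
  hence "walk (comb_seq (k * m) \<omega> \<omega>') a = walk \<omega> a" by (rule walk_comb_seq_le)
  thus ?thesis
    unfolding returns_walk visits_def k_def[symmetric] hits_comb_seq_future[OF assms(1)] by simp
qed

context random_walk
begin

lemma visits_measurable [measurable]: "(\<lambda>\<omega>. real (visits x m r \<omega>)) \<in> borel_measurable S"
  unfolding visits_def of_nat_sum of_nat_of_bool by measurable

lemma visits_pred [measurable]: "Measurable.pred S (\<lambda>\<omega>. q \<le> visits x m r \<omega>)"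
proof -
  have "Measurable.pred S (\<lambda>\<omega>. real q \<le> real (visits x m r \<omega>))" by measurable
  thus ?thesis by simp
qed

lemma visits_expectation:
  "integrable S (\<lambda>\<omega>. real (visits x m r \<omega>))"
  "(\<integral>\<omega>. real (visits x m r \<omega>) \<partial>S) = (\<Sum>j<r. \<P>(\<omega> in S. hits x m j \<omega>))"
proof -
  have eq: "real (visits x m r \<omega>) = (\<Sum>j<r. indicator {\<omega>. hits x m j \<omega>} \<omega>)" for \<omega>
    by (simp add: visits_def indicator_def)
  have int: "integrable S (indicator {\<omega>. hits x m j \<omega>} :: _ \<Rightarrow> real)" for j
    by (rule integrable_event) measurable
  show "integrable S (\<lambda>\<omega>. real (visits x m r \<omega>))" unfolding eq using int by simp
  show "(\<integral>\<omega>. real (visits x m r \<omega>) \<partial>S) = (\<Sum>j<r. \<P>(\<omega> in S. hits x m j \<omega>))"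
    unfolding eq using int by (simp add: Bochner_Integration.integral_sum)
qed

text \<open>
  By Markov's inequality \<open>L\<close> visited blocks occur with probability at most \<open>1/2\<close>.  At the end of the
  \<open>L\<close>-th visited block the walk starts afresh from some other point; as the assumption holds for every
  starting point, each further group of \<open>L\<close> visits costs another factor \<open>1/2\<close>.
\<close>
lemma visits_tail:
  assumes m: "0 < m" and L: "0 < L"
    and mean: "\<And>x. (\<Sum>j<r. \<P>(\<omega> in S. hits x m j \<omega>)) \<le> L / 2"
  shows "\<P>(\<omega> in S. k * L \<le> visits x m r \<omega>) \<le> (1 / 2) ^ k"
proof (induction k arbitrary: x)
  case 0
  show ?case by simp
next
  case (Suc k)
  \<comment> \<open>\<open>B j\<close> says that \<open>j\<close> is the \<open>L\<close>-th visited block; it is decided at time \<open>Suc j * m\<close>.\<close>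
  define B where "B j \<omega> \<longleftrightarrow> visits x m j \<omega> < L \<and> L \<le> visits x m (Suc j) \<omega>" for j \<omega>
  define E where "E \<omega> \<longleftrightarrow> Suc k * L \<le> visits x m r \<omega>" for \<omega>
  have [measurable]: "Measurable.pred S (B j)" "Measurable.pred S E" for j
    unfolding B_def E_def not_le[symmetric] by measurable
  have sets: "{\<omega>. B j \<omega>} \<in> sets S" "{\<omega>. B j \<omega> \<and> E \<omega>} \<in> sets S" "{\<omega>. L \<le> visits x m r \<omega>} \<in> sets S" for j
    by (auto intro!: event_sets)
  have disj: "i = j" if "B i \<omega>" "B j \<omega>" for i j \<omega>
  proof (rule ccontr)
    assume "i \<noteq> j"
    then consider "Suc i \<le> j" | "Suc j \<le> i" by linarith
    thus False
      using that visits_mono[of "Suc i" j x m \<omega>] visits_mono[of "Suc j" i x m \<omega>] by cases (auto simp: B_def)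
  qed
  have step: "\<P>(\<omega> in S. B j \<omega> \<and> E \<omega>) \<le> (1 / 2) ^ k * \<P>(\<omega> in S. B j \<omega>)" if j: "j < r" for j
  proof (rule markov_le[where t = "Suc j * m"])
    fix \<omega> \<omega>'
    have past: "hits x m i (comb_seq (Suc j * m) \<omega> \<omega>') \<longleftrightarrow> hits x m i \<omega>" if "i < Suc j" for i
      using that m by (intro hits_comb_seq_past mult_le_mono1) auto
    have "visits x m i (comb_seq (Suc j * m) \<omega> \<omega>') = visits x m i \<omega>" if "i \<le> Suc j" for i
      unfolding visits_def using that by (intro sum.cong refl arg_cong[of _ _ of_bool] past) auto
    thus "B j (comb_seq (Suc j * m) \<omega> \<omega>') \<longleftrightarrow> B j \<omega>" by (simp add: B_def)
  next
    fix \<omega> assume B: "B j \<omega>"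
    define y where "y = x + walk \<omega> (Suc j * m)"
    have L_eq: "visits x m (Suc j) \<omega> = L" using B by (auto simp: B_def visits_def of_bool_def split: if_splits)
    have "k * L \<le> visits y m r \<omega>'" if "E (comb_seq (Suc j * m) \<omega> \<omega>')" for \<omega>'
    proof -
      have "visits x m r (comb_seq (Suc j * m) \<omega> \<omega>') = L + visits y m (r - Suc j) \<omega>'"
        using visits_comb_seq[OF m, of x "Suc j" "r - Suc j" \<omega> \<omega>'] j by (simp add: L_eq y_def)
      hence "k * L \<le> visits y m (r - Suc j) \<omega>'" using that by (simp add: E_def)
      also have "\<dots> \<le> visits y m r \<omega>'" by (rule visits_mono) simp
      finally show ?thesis .
    qed
    hence "\<P>(\<omega>' in S. E (comb_seq (Suc j * m) \<omega> \<omega>')) \<le> \<P>(\<omega>' in S. k * L \<le> visits y m r \<omega>')"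
      by (intro P.finite_measure_mono) (auto intro!: event_sets)
    also have "\<dots> \<le> (1 / 2) ^ k" by (rule Suc.IH)
    finally show "\<P>(\<omega>' in S. E (comb_seq (Suc j * m) \<omega> \<omega>')) \<le> (1 / 2) ^ k" .
  qed measurable
  have "measure S {\<omega>. E \<omega>} \<le> measure S (\<Union>j<r. {\<omega>. B j \<omega> \<and> E \<omega>})"
  proof (rule P.finite_measure_mono)
    show "{\<omega>. E \<omega>} \<subseteq> (\<Union>j<r. {\<omega>. B j \<omega> \<and> E \<omega>})"
    proof
      fix \<omega> assume "\<omega> \<in> {\<omega>. E \<omega>}"
      hence E: "E \<omega>" by simp
      hence "L \<le> visits x m r \<omega>" by (simp add: E_def)
      from visits_crossing[OF this L] E show "\<omega> \<in> (\<Union>j<r. {\<omega>. B j \<omega> \<and> E \<omega>})" by (auto simp: B_def)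
    qed
  qed (use sets in auto)
  also have "\<dots> \<le> (\<Sum>j<r. measure S {\<omega>. B j \<omega> \<and> E \<omega>})"
    using sets by (intro P.finite_measure_subadditive_finite) auto
  also have "\<dots> \<le> (\<Sum>j<r. (1 / 2) ^ k * measure S {\<omega>. B j \<omega>})"
    using step by (intro sum_mono) simp
  also have "\<dots> = (1 / 2) ^ k * (\<Sum>j<r. measure S {\<omega>. B j \<omega>})" by (simp add: sum_distrib_left)
  also have "(\<Sum>j<r. measure S {\<omega>. B j \<omega>}) = measure S (\<Union>j<r. {\<omega>. B j \<omega>})"
    using sets disj by (intro P.finite_measure_finite_Union[symmetric]) (auto simp: disjoint_family_on_def)
  also have "\<dots> \<le> measure S {\<omega>. L \<le> visits x m r \<omega>}"
  proof (rule P.finite_measure_mono)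
    show "(\<Union>j<r. {\<omega>. B j \<omega>}) \<subseteq> {\<omega>. L \<le> visits x m r \<omega>}"
    proof safe
      fix j \<omega> assume "j < r" "B j \<omega>"
      thus "L \<le> visits x m r \<omega>" using visits_mono[of "Suc j" r x m \<omega>] by (auto simp: B_def)
    qed
  qed (use sets in auto)
  also have "\<dots> \<le> (\<integral>\<omega>. real (visits x m r \<omega>) \<partial>S) / L"
  proof -
    have "measure S {\<omega> \<in> space S. real L \<le> real (visits x m r \<omega>)} \<le> (\<integral>\<omega>. real (visits x m r \<omega>) \<partial>S) / L"
      using L visits_expectation(1) by (intro integral_Markov_inequality_measure[where A = "{}"]) auto
    thus ?thesis by simp
  qed
  also have "\<dots> \<le> 1 / 2" using mean[of x] L unfolding visits_expectation(2) by (simp add: field_simps)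
  finally show ?case by (simp add: E_def mult_left_mono)
qed

lemma returns_pred [measurable]: "Measurable.pred S (\<lambda>\<omega>. q \<le> returns (walk \<omega>) r m a)"
proof -
  have "(\<lambda>\<omega>. real (returns (walk \<omega>) r m a)) \<in> borel_measurable S"
    unfolding returns_walk of_nat_sum of_nat_of_bool hits_def by measurable
  hence "Measurable.pred S (\<lambda>\<omega>. real q \<le> real (returns (walk \<omega>) r m a))" by measurable
  thus ?thesis by simp
qed

text \<open>
  Conditionally on the steps up to the end of the block of \<open>a\<close>, the returns to the level of the walk at
  \<open>a\<close> are visits of a fresh walk to a strip around a fixed level.
\<close>
lemma returns_tail:
  assumes m: "0 < m" and L: "0 < L"
    and mean: "\<And>x. (\<Sum>j<r. \<P>(\<omega> in S. hits x m j \<omega>)) \<le> L / 2"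
  shows "\<P>(\<omega> in S. k * L \<le> returns (walk \<omega>) r m a) \<le> (1 / 2) ^ k"
proof -
  have "\<P>(\<omega> in S. True \<and> k * L \<le> returns (walk \<omega>) r m a) \<le> (1 / 2) ^ k * \<P>(\<omega> in S. True)"
  proof (rule markov_le[where t = "Suc (a div m) * m"])
    fix \<omega>
    show "\<P>(\<omega>' in S. k * L \<le> returns (walk (comb_seq (Suc (a div m) * m) \<omega> \<omega>')) r m a) \<le> (1 / 2) ^ k"
      unfolding returns_comb_seq[OF m] by (rule visits_tail) fact+
  qed measurable
  thus ?thesis by simp
qed

end

section \<open>Longest increasing subsets of the walk\<close>
lemma LIS_le:
  assumes "\<And>A. A \<subseteq> {0..<n} \<Longrightarrow> mono_on A f \<Longrightarrow> real (card A) \<le> c"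
  shows "real (LIS f {0..<n}) \<le> c"
proof -
  have "finite {card A |A. A \<subseteq> {0..<n} \<and> mono_on A f}"
    by (rule finite_subset[of _ "card ` Pow {0..<n}"]) auto
  moreover have "{card A |A. A \<subseteq> {0..<n} \<and> mono_on A f} \<noteq> {}"
    by (auto intro!: exI[of _ "{}"])
  ultimately have "LIS f {0..<n} \<in> {card A |A. A \<subseteq> {0..<n} \<and> mono_on A f}"
    unfolding LIS_def by (rule Max_in)
  thus ?thesis using assms by auto
qed

context random_walk
begin

text \<open>
  \<open>Z\<close> combines the trivial bound \<open>n\<close> on the exceptional event, where some index has too many returns at
  some scale, with \<open>card_increasing_le\<close> elsewhere.  Working with an integrable dominating function
  avoids any question of measurability for \<open>LIS\<close>.
\<close>
lemma LIS_dominated: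
  "\<exists>K :: real. 1 \<le> K \<and> (\<forall>n r J k :: nat. 0 < r \<longrightarrow> n \<le> r ^ J \<longrightarrow> 0 < k \<longrightarrow>
     (\<exists>Z. integrable S Z \<and> (\<forall>\<omega>. real (LIS (walk \<omega>) {0..<n}) \<le> Z \<omega>) \<and>
       (\<integral>\<omega>. Z \<omega> \<partial>S) \<le> real n * (real n * real J * (1 / 2) ^ k) + (1 + 2 * real J) * (K * real k * sqrt (real r)) ^ J
         + 2 * real J * (K * real k) ^ J * sqrt (real r) * (2 * sqrt (real n * variance_step))))"
proof -
  obtain C where C: "0 < C" and mean: "\<And>x m r. 0 < m \<Longrightarrow> 0 < r \<Longrightarrow> (\<Sum>j<r. \<P>(\<omega> in S. hits x m j \<omega>)) \<le> C * sqrt r"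
    using expected_visits_bound by meson
  define K where "K = 2 * C + 1"
  show ?thesis
  proof (rule exI[of _ K], intro conjI allI impI)
    show "1 \<le> K" using C by (simp add: K_def)
    fix n r J k :: nat
    assume r: "0 < r" and n: "n \<le> r ^ J" and k: "0 < k"
    define L where "L = nat \<lceil>2 * C * sqrt r\<rceil>"
    have "1 \<le> sqrt r" using r by simp
    have "0 < 2 * C * sqrt r" using C r by simp
    hence "0 < L" "2 * C * sqrt r \<le> L" "L \<le> 2 * C * sqrt r + 1" unfolding L_def by linarith+
    moreover have "2 * C * sqrt r + 1 \<le> K * sqrt r" using \<open>1 \<le> sqrt r\<close> by (simp add: K_def algebra_simps)
    ultimately have L: "0 < L" "2 * C * sqrt r \<le> L" "L \<le> K * sqrt r" by simp_all
    define bad where "bad \<omega> \<longleftrightarrow> (\<exists>a<n. \<exists>i<J. k * L \<le> returns (walk \<omega>) r (r ^ i) a)" for \<omega>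
    have [measurable]: "Measurable.pred S bad" unfolding bad_def by measurable
    have bad: "measure S {\<omega>. bad \<omega>} \<le> real n * real J * (1 / 2) ^ k"
    proof -
      have "measure S {\<omega>. bad \<omega>} \<le> measure S (\<Union>p\<in>{..<n} \<times> {..<J}. {\<omega>. k * L \<le> returns (walk \<omega>) r (r ^ snd p) (fst p)})"
        by (intro P.finite_measure_mono sets.finite_UN event_sets) (auto simp: bad_def)
      also have "\<dots> \<le> (\<Sum>p\<in>{..<n} \<times> {..<J}. measure S {\<omega>. k * L \<le> returns (walk \<omega>) r (r ^ snd p) (fst p)})"
        by (intro P.finite_measure_subadditive_finite) (auto intro!: event_sets)
      also have "\<dots> \<le> (\<Sum>p\<in>{..<n} \<times> {..<J}. (1 / 2) ^ k)"
      proof (rule sum_mono)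
        fix p :: "nat \<times> nat"
        have "(\<Sum>j<r. \<P>(\<omega> in S. hits x (r ^ snd p) j \<omega>)) \<le> L / 2" for x
          using mean[of "r ^ snd p" r x] r L by simp
        from returns_tail[OF _ L(1) this, of k "fst p"] r
        show "measure S {\<omega>. k * L \<le> returns (walk \<omega>) r (r ^ snd p) (fst p)} \<le> (1 / 2) ^ k" by simp
      qed
      finally show ?thesis by (simp add: mult.assoc)
    qed
    define D1 where "D1 = (1 + 2 * real J) * (K * real k * sqrt (real r)) ^ J"
    define D2 where "D2 = 2 * real J * (K * real k) ^ J * sqrt (real r)"
    have "1 \<le> K" using C by (simp add: K_def)
    hence Kk: "1 \<le> K * k" using k mult_mono[of 1 K 1 "real k"] by simp
    hence Kkr: "1 \<le> K * k * sqrt r" using \<open>1 \<le> sqrt r\<close> mult_mono[of 1 "K * k" 1 "sqrt r"] by simp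
    have D: "0 \<le> D1" "0 \<le> D2" using Kk Kkr by (auto simp: D1_def D2_def)
    define Z where "Z \<omega> = real n * indicator {\<omega>. bad \<omega>} \<omega> + D1 + D2 * running_max \<omega> n" for \<omega>
    have bad_int: "integrable S (indicator {\<omega>. bad \<omega>} :: _ \<Rightarrow> real)" by (rule integrable_event) measurable
    have "real (LIS (walk \<omega>) {0..<n}) \<le> Z \<omega>" for \<omega>
    proof (rule LIS_le)
      fix A assume A: "A \<subseteq> {0..<n}" "mono_on A (walk \<omega>)"
      show "real (card A) \<le> Z \<omega>"
      proof (cases "bad \<omega>")
        case True
        have "card A \<le> n" using card_mono[OF _ A(1)] by simp
        thus ?thesis using True D running_max_nonneg[of \<omega> n] by (simp add: Z_def add_increasing2)
      next
        case False
        define H where "H = running_max \<omega> n"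
        have H: "0 \<le> H" by (simp add: H_def running_max_nonneg)
        define Q where "Q = k * L"
        have Q: "real Q \<le> K * k * sqrt r" using mult_left_mono[OF L(3), of "real k"] by (simp add: Q_def mult_ac)
        have "real (card A) \<le> real Q ^ J + (\<Sum>i<J. real Q ^ Suc i * (2 * H / sqrt (r ^ i) + 2))"
        proof (rule card_increasing_le[OF A r n])
          show "\<bar>walk \<omega> t\<bar> \<le> H" if "t < n" for t
            using that abs_walk_le_running_max[of t n \<omega>] by (simp add: H_def)
          show "returns (walk \<omega>) r (r ^ i) a < Q" if "a < n" "i < J" for a i
            using False that by (auto simp: bad_def Q_def not_le)
        qed fact
        also have "\<dots> \<le> (K * k * sqrt r) ^ J + (\<Sum>i<J. 2 * ((K * k) ^ J * sqrt r) * H + 2 * (K * k * sqrt r) ^ J)"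
        proof (intro add_mono sum_mono power_mono Q)
          fix i assume i: "i \<in> {..<J}"
          have "real Q ^ Suc i * (2 * H / sqrt (r ^ i) + 2) \<le> (K * k * sqrt r) ^ Suc i * (2 * H / sqrt (r ^ i) + 2)"
            using Q H by (intro mult_right_mono power_mono) auto
          \<comment> \<open>Here \<open>sqrt r ^ i\<close> cancels against the height \<open>sqrt (r ^ i)\<close> of the strips.\<close>
          also have "\<dots> = 2 * ((K * k) ^ Suc i * sqrt r) * H + 2 * (K * k * sqrt r) ^ Suc i"
            using r by (simp add: power_mult_distrib real_sqrt_power field_simps)
          also have "\<dots> \<le> 2 * ((K * k) ^ J * sqrt r) * H + 2 * (K * k * sqrt r) ^ J"
            using i H Kk Kkr by (intro add_mono mult_left_mono mult_right_mono power_increasing) auto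
          finally show "real Q ^ Suc i * (2 * H / sqrt (r ^ i) + 2) \<le> \<dots>" .
        qed auto
        also have "\<dots> = D1 + D2 * H" by (simp add: D1_def D2_def algebra_simps)
        finally show ?thesis using False by (simp add: Z_def H_def)
      qed
    qed
    moreover have "integrable S Z" unfolding Z_def using bad_int running_max_integrable by simp
    moreover have "(\<integral>\<omega>. Z \<omega> \<partial>S) = real n * measure S {\<omega>. bad \<omega>} + D1 + D2 * (\<integral>\<omega>. running_max \<omega> n \<partial>S)"
      unfolding Z_def using bad_int running_max_integrable by simp
    moreover have "\<dots> \<le> real n * (real n * real J * (1 / 2) ^ k) + D1 + D2 * (2 * sqrt (n * variance_step))"
      using bad running_max_expectation D by (intro add_mono mult_left_mono order_refl) auto
    ultimately show "\<exists>Z. integrable S Z \<and> (\<forall>\<omega>. real (LIS (walk \<omega>) {0..<n}) \<le> Z \<omega>) \<and>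
       (\<integral>\<omega>. Z \<omega> \<partial>S) \<le> real n * (real n * real J * (1 / 2) ^ k) + (1 + 2 * real J) * (K * real k * sqrt (real r)) ^ J
         + 2 * real J * (K * real k) ^ J * sqrt (real r) * (2 * sqrt (real n * variance_step))"
      unfolding D1_def D2_def by (intro exI[of _ Z]) simp
  qed
qed

end

text \<open>
  The exceptional event has probability at most \<open>n * J * (1 / 2) ^ k\<close>; with this \<open>k\<close>, the trivial bound
  \<open>n\<close> on that event contributes at most \<open>J\<close> to the expectation.  The price is a factor \<open>k\<close> at every
  scale, which any positive power \<open>n powr a\<close> dominates.
\<close>
lemma multiscale_parameters:
  fixes n J :: nat and a :: real
  assumes n: "2 \<le> n" and J: "0 < J" and a: "0 < a"
  defines "k \<equiv> nat \<lceil>2 * log 2 n\<rceil>" and "r \<equiv> nat \<lceil>n powr (1 / J)\<rceil>"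
  shows "0 < k" "0 < r" "n \<le> r ^ J" "(1 / 2) ^ k \<le> 1 / (real n)\<^sup>2"
    "k \<le> (2 / (a * ln 2) + 1) * n powr a" "r \<le> 2 * n powr (1 / J)"
proof -
  have ln2: "0 < ln (2::real)" by simp
  have log: "1 \<le> log 2 n" using n by simp
  hence "0 < 2 * log 2 n" by simp
  thus "0 < k" by (simp add: k_def)
  have p1: "1 \<le> n powr (1 / J)" using n by (intro ge_one_powr_ge_zero) auto
  thus "0 < r" unfolding r_def by linarith
  show "r \<le> 2 * n powr (1 / J)" using p1 unfolding r_def by linarith
  have "real n = (n powr (1 / J)) ^ J" using n J by (simp add: powr_realpow[symmetric] powr_powr)
  also have "\<dots> \<le> real r ^ J" unfolding r_def by (intro power_mono real_nat_ceiling_ge) simp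
  finally show "n \<le> r ^ J" by (simp flip: of_nat_power)
  have "2 * log 2 n \<le> k" unfolding k_def by linarith
  hence "(2::real) powr (2 * log 2 n) \<le> 2 powr k" by simp
  moreover have "(2::real) powr (2 * log 2 n) = (real n)\<^sup>2"
    using n by (simp add: mult.commute[of 2] powr_powr[symmetric] flip: powr_numeral)
  ultimately have "(real n)\<^sup>2 \<le> 2 ^ k" by (simp add: powr_realpow)
  thus "(1 / 2) ^ k \<le> 1 / (real n)\<^sup>2" using n by (simp add: power_divide divide_simps)
  have "k \<le> 2 * log 2 n + 1" using log unfolding k_def by linarith
  also have "\<dots> \<le> 2 / (a * ln 2) * n powr a + n powr a"
  proof (intro add_mono)
    have "ln n \<le> n powr a / a" using n a by (intro ln_powr_bound) auto
    hence "2 * (ln n / ln 2) \<le> 2 * (n powr a / a / ln 2)" using ln2 by (intro mult_left_mono divide_right_mono) auto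
    thus "2 * log 2 n \<le> 2 / (a * ln 2) * n powr a" by (simp add: log_def)
    show "1 \<le> n powr a" using n a by (intro ge_one_powr_ge_zero) auto
  qed
  finally show "k \<le> (2 / (a * ln 2) + 1) * n powr a" by (simp add: distrib_right)
qed

context random_walk
begin

text \<open>
  With \<open>1 / J \<le> \<epsilon> / 4\<close> and \<open>a * J = \<epsilon> / 4\<close>, the powers of \<open>k\<close> and the surplus \<open>sqrt r\<close> together
  contribute an exponent of at most \<open>\<epsilon> / 2\<close>; the other half of \<open>\<epsilon>\<close> absorbs the constant \<open>B\<close>.
\<close>
theorem LIS_dominated_eventually:
  assumes "0 < \<epsilon>"
  shows "\<forall>\<^sub>F n in sequentially. \<exists>Z. integrable S Z \<and> (\<forall>\<omega>. real (LIS (walk \<omega>) {0..<n}) \<le> Z \<omega>) \<and>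
    (\<integral>\<omega>. Z \<omega> \<partial>S) \<le> n powr (1 / 2 + \<epsilon>)"
proof -
  obtain K where K: "1 \<le> K" and dom: "\<And>n r J k. 0 < r \<Longrightarrow> n \<le> r ^ J \<Longrightarrow> 0 < k \<Longrightarrow>
     \<exists>Z. integrable S Z \<and> (\<forall>\<omega>. real (LIS (walk \<omega>) {0..<n}) \<le> Z \<omega>) \<and>
       (\<integral>\<omega>. Z \<omega> \<partial>S) \<le> real n * (real n * real J * (1 / 2) ^ k) + (1 + 2 * real J) * (K * real k * sqrt (real r)) ^ J
         + 2 * real J * (K * real k) ^ J * sqrt (real r) * (2 * sqrt (real n * variance_step))"
    using LIS_dominated by meson
  define J where "J = nat \<lceil>4 / \<epsilon>\<rceil>"
  have "0 < 4 / \<epsilon>" using assms by simp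
  hence J: "0 < J" "4 / \<epsilon> \<le> J" unfolding J_def by linarith+
  hence J_inv: "1 / J \<le> \<epsilon> / 4" using assms by (simp add: field_simps)
  define a where "a = \<epsilon> / (4 * J)"
  have a: "0 < a" "a * J = \<epsilon> / 4" using assms J by (auto simp: a_def)
  define A where "A = 2 / (a * ln 2) + 1"
  have A: "0 < A" using a by (simp add: A_def add_pos_pos)
  define v where "v = sqrt variance_step"
  have v: "0 < v" using variance_step_pos by (simp add: v_def)
  define B where "B = real J + (1 + 2 * real J) * (K * A * 2) ^ J + 2 * real J * (K * A) ^ J * 2 * (2 * v)"
  have "filterlim (\<lambda>n::nat. real n powr (\<epsilon> / 2)) at_top sequentially"
    using assms by real_asymp
  hence "\<forall>\<^sub>F n in sequentially. B \<le> real n powr (\<epsilon> / 2)" by (simp add: filterlim_at_top)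
  with eventually_ge_at_top[of 2] show ?thesis
  proof eventually_elim
    case (elim n)
    define k where "k = nat \<lceil>2 * log 2 n\<rceil>"
    define r where "r = nat \<lceil>n powr (1 / J)\<rceil>"
    note par = multiscale_parameters[OF elim(1) J(1) a(1), folded k_def r_def A_def]
    obtain Z where Z: "integrable S Z" "\<forall>\<omega>. real (LIS (walk \<omega>) {0..<n}) \<le> Z \<omega>"
      and Z_le: "(\<integral>\<omega>. Z \<omega> \<partial>S) \<le> real n * (real n * real J * (1 / 2) ^ k) + (1 + 2 * real J) * (K * real k * sqrt (real r)) ^ J
         + 2 * real J * (K * real k) ^ J * sqrt (real r) * (2 * sqrt (real n * variance_step))"
      using dom[OF par(2,3,1)] by blast
    have n1: "1 \<le> real n" using elim by simp
    define N where "N = n powr (1 / 2 + \<epsilon> / 2)"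
    have le_N: "n powr s \<le> N" if "s \<le> 1 / 2 + \<epsilon> / 2" for s
      unfolding N_def using n1 that by (rule powr_mono[rotated])
    have sqrt_r: "sqrt r \<le> 2 * n powr (1 / (2 * J))"
    proof -
      have "sqrt r \<le> sqrt (4 * n powr (1 / J))" using par(6) n1 by (simp add: order_trans[OF par(6)])
      also have "\<dots> = 2 * n powr (1 / (2 * J))" by (simp add: real_sqrt_mult powr_half_sqrt[symmetric] powr_powr mult.commute)
      finally show ?thesis .
    qed
    have Kk: "(K * real k) ^ J \<le> (K * A) ^ J * n powr (\<epsilon> / 4)"
    proof -
      have "(K * real k) ^ J \<le> (K * (A * n powr a)) ^ J" using K par(5) by (intro power_mono mult_left_mono) auto
      also have "\<dots> = (K * A) ^ J * (n powr a) ^ J" by (simp add: power_mult_distrib)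
      also have "(n powr a) ^ J = n powr (\<epsilon> / 4)" using n1 by (simp add: powr_realpow[symmetric] powr_powr a(2))
      finally show ?thesis .
    qed
    have "real n * (real n * real J * (1 / 2) ^ k) \<le> real n * (real n * real J * (1 / (real n)\<^sup>2))"
      using par(4) by (intro mult_left_mono) auto
    also have "\<dots> = J * n powr 0" using n1 by (simp add: power2_eq_square)
    also have "\<dots> \<le> J * N" using assms by (intro mult_left_mono le_N) auto
    finally have 1: "real n * (real n * real J * (1 / 2) ^ k) \<le> J * N" .
    have "(K * real k * sqrt (real r)) ^ J = (K * real k) ^ J * sqrt r ^ J" by (simp add: power_mult_distrib)
    also have "\<dots> \<le> ((K * A) ^ J * n powr (\<epsilon> / 4)) * (2 * n powr (1 / (2 * J))) ^ J"
      using Kk sqrt_r K A by (intro mult_mono power_mono) auto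
    also have "(2 * n powr (1 / (2 * J))) ^ J = 2 ^ J * n powr (1 / 2)"
      using n1 J by (simp add: power_mult_distrib powr_realpow[symmetric] powr_powr)
    also have "(K * A) ^ J * n powr (\<epsilon> / 4) * (2 ^ J * n powr (1 / 2)) = (K * A * 2) ^ J * n powr (\<epsilon> / 4 + 1 / 2)"
      by (simp add: powr_add power_mult_distrib)
    also have "\<dots> \<le> (K * A * 2) ^ J * N" using K A assms by (intro mult_left_mono le_N) auto
    finally have "(1 + 2 * real J) * (K * real k * sqrt (real r)) ^ J \<le> (1 + 2 * real J) * ((K * A * 2) ^ J * N)"
      by (rule mult_left_mono) simp
    hence 2: "(1 + 2 * real J) * (K * real k * sqrt (real r)) ^ J \<le> (1 + 2 * real J) * (K * A * 2) ^ J * N" by (simp add: mult.assoc)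
    have "2 * real J * (K * real k) ^ J * sqrt (real r) * (2 * sqrt (real n * variance_step))
        \<le> 2 * real J * ((K * A) ^ J * n powr (\<epsilon> / 4)) * (2 * n powr (1 / (2 * J))) * (2 * (n powr (1 / 2) * v))"
      using Kk sqrt_r K A v n1
      by (intro mult_mono mult_left_mono) (auto simp: powr_half_sqrt real_sqrt_mult v_def)
    also have "\<dots> = 2 * real J * (K * A) ^ J * 2 * (2 * v) * n powr (\<epsilon> / 4 + 1 / (2 * J) + 1 / 2)"
      by (simp add: powr_add)
    also have "\<dots> \<le> 2 * real J * (K * A) ^ J * 2 * (2 * v) * N"
      using K A v J_inv assms by (intro mult_left_mono le_N) auto
    finally have 3: "2 * real J * (K * real k) ^ J * sqrt (real r) * (2 * sqrt (real n * variance_step))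
        \<le> 2 * real J * (K * A) ^ J * 2 * (2 * v) * N" .
    have "(\<integral>\<omega>. Z \<omega> \<partial>S) \<le> J * N + (1 + 2 * real J) * (K * A * 2) ^ J * N + 2 * real J * (K * A) ^ J * 2 * (2 * v) * N"
      using Z_le 1 2 3 by linarith
    also have "\<dots> = B * N" by (simp add: B_def distrib_right)
    also have "\<dots> \<le> n powr (\<epsilon> / 2) * N" using elim by (intro mult_right_mono) (auto simp: N_def)
    also have "\<dots> = n powr (1 / 2 + \<epsilon>)" by (simp add: N_def add.commute flip: powr_add)
    finally show ?case using Z by blast
  qed
qed

end

lemma partial_sum_eq_walk: "partial_sum X \<omega> = walk (\<lambda>i. X (Suc i) \<omega>)"
  by (simp add: partial_sum_def walk_def fun_eq_iff sum.atLeast1_atMost_eq)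

text \<open>
  The steps \<open>X (Suc i)\<close> are transported to the space of step sequences, where their joint law is a
  product measure by independence and equality of the marginal laws.
\<close>
theorem corollary1p2:
  fixes M :: "'a measure" and X :: "nat \<Rightarrow> 'a \<Rightarrow> real" and \<epsilon> :: real
  assumes "prob_space M"
    and "prob_space.indep_vars M (\<lambda>_. borel) X {1..}"
    and "\<And>i. i \<ge> 1 \<Longrightarrow> distr M borel (X i) = distr M borel (X 1)"
    and "integrable M (X 1)"
    and "prob_space.expectation M (X 1) = 0"
    and "integrable M (\<lambda>\<omega>. (X 1 \<omega>)\<^sup>2)"
    and "prob_space.variance M (X 1) > 0"
    and "\<epsilon> > 0"
  shows "\<forall>\<^sub>F n in sequentially.
           prob_space.expectation M (\<lambda>\<omega>. real (LIS (partial_sum X \<omega>) {0..<n}))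
             \<le> real n powr (1 / 2 + \<epsilon>)"
proof -
  interpret M: prob_space M by fact
  define \<mu> where "\<mu> = distr M borel (X 1)"
  have rv: "X i \<in> borel_measurable M" if "1 \<le> i" for i
    using assms(2) that unfolding M.indep_vars_def by auto
  have rv1 [measurable]: "X 1 \<in> borel_measurable M" by (rule rv) simp
  have square: "(\<integral>x. x\<^sup>2 \<partial>\<mu>) = (\<integral>\<omega>. (X 1 \<omega>)\<^sup>2 \<partial>M)" unfolding \<mu>_def by (rule integral_distr[OF rv1]) simp
  interpret random_walk \<mu>
  proof (intro random_walk.intro random_walk_axioms.intro)
    show "prob_space \<mu>" unfolding \<mu>_def by (rule M.prob_space_distr) (rule rv1)
    show "sets \<mu> = sets borel" by (simp add: \<mu>_def)
    show "integrable \<mu> (\<lambda>x. x\<^sup>2)" unfolding \<mu>_def using assms(6) by (subst integrable_distr_eq[OF rv1]) simp_all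
    show "(\<integral>x. x \<partial>\<mu>) = 0" unfolding \<mu>_def using assms(5) by (subst integral_distr[OF rv1]) simp_all
    show "0 < (\<integral>x. x\<^sup>2 \<partial>\<mu>)" using assms(5,7) by (simp add: square)
  qed
  define Y where "Y \<omega> i = X (Suc i) \<omega>" for \<omega> i
  have Y_rv: "(\<lambda>\<omega>. Y \<omega> i) \<in> borel_measurable M" for i unfolding Y_def by (rule rv) simp
  have Y: "Y \<in> measurable M S"
  proof -
    have "(\<lambda>\<omega>. \<lambda>i\<in>UNIV. Y \<omega> i) \<in> measurable M S"
      using Y_rv by (intro measurable_restrict) (simp add: measurable_cong_sets[OF refl sets_step])
    thus ?thesis by (simp add: restrict_UNIV)
  qed
  have law: "distr M S Y = S"
  proof -
    have X: "(\<lambda>\<omega>. \<lambda>i\<in>{1..}. X i \<omega>) \<in> measurable M (\<Pi>\<^sub>M i\<in>{1..}. \<mu>)"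
      using rv by (intro measurable_restrict) (simp add: measurable_cong_sets[OF refl sets_step])
    have shift: "(\<lambda>\<omega>. \<lambda>i\<in>UNIV. \<omega> (Suc i)) \<in> measurable (\<Pi>\<^sub>M i\<in>{1..}. \<mu>) S"
      by (intro measurable_restrict measurable_component_singleton) simp
    have "distr M (\<Pi>\<^sub>M i\<in>{1..}. \<mu>) (\<lambda>\<omega>. \<lambda>i\<in>{1..}. X i \<omega>)
        = distr M (\<Pi>\<^sub>M i\<in>{1..}. borel) (\<lambda>\<omega>. \<lambda>i\<in>{1..}. X i \<omega>)"
      by (rule distr_cong) (auto simp: sets_step intro!: sets_PiM_cong)
    also have "\<dots> = (\<Pi>\<^sub>M i\<in>{1..}. distr M borel (X i))"
      using assms(2) rv by (subst M.indep_vars_iff_distr_eq_PiM'[symmetric]) auto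
    also have "\<dots> = (\<Pi>\<^sub>M i\<in>{1..}. \<mu>)" unfolding \<mu>_def by (intro PiM_cong refl assms(3)) simp
    finally have joint: "distr M (\<Pi>\<^sub>M i\<in>{1..}. \<mu>) (\<lambda>\<omega>. \<lambda>i\<in>{1..}. X i \<omega>) = (\<Pi>\<^sub>M i\<in>{1..}. \<mu>)" .
    have "distr M S Y = distr (distr M (\<Pi>\<^sub>M i\<in>{1..}. \<mu>) (\<lambda>\<omega>. \<lambda>i\<in>{1..}. X i \<omega>)) S (\<lambda>\<omega>. \<lambda>i\<in>UNIV. \<omega> (Suc i))"
      by (subst distr_distr[OF shift X]) (auto simp: Y_def comp_def intro!: distr_cong)
    also have "\<dots> = S" unfolding joint by (rule distr_PiM_reindex) (auto intro: step.prob_space_axioms)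
    finally show ?thesis .
  qed
  show ?thesis
    using LIS_dominated_eventually[OF assms(8)]
  proof eventually_elim
    case (elim n)
    then obtain Z where Z: "integrable S Z" "\<And>\<omega>. real (LIS (walk \<omega>) {0..<n}) \<le> Z \<omega>"
      "(\<integral>\<omega>. Z \<omega> \<partial>S) \<le> n powr (1 / 2 + \<epsilon>)" by blast
    have "M.expectation (\<lambda>\<omega>. real (LIS (partial_sum X \<omega>) {0..<n})) \<le> M.expectation (\<lambda>\<omega>. Z (Y \<omega>))"
    proof (rule integral_mono')
      show "integrable M (\<lambda>\<omega>. Z (Y \<omega>))" using Z(1) integrable_distr[OF Y, of Z] by (simp add: law)
      show "real (LIS (partial_sum X \<omega>) {0..<n}) \<le> Z (Y \<omega>)" for \<omega>
        using Z(2)[of "Y \<omega>"] unfolding partial_sum_eq_walk Y_def[abs_def] .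
      show "0 \<le> Z (Y \<omega>)" for \<omega> using Z(2)[of "Y \<omega>"] by (rule order_trans[rotated]) simp
    qed
    also have "\<dots> = (\<integral>\<omega>. Z \<omega> \<partial>S)"
      using integral_distr[OF Y, of Z] Z(1) by (simp add: law)
    finally show ?case using Z(3) by simp
  qed
qed

end
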